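(* Let $\mu$ be an admissible measure on $\mathbb{R}^d$. There exists an admissible measure on $\mathbb{R}^d$, different from $\mu$, with the same power moments as $\mu$ if and only if there exist $\xi \in \mathbb{R}^d \setminus \{0\}$ and $\epsilon \in \{0, -\pi/2\}$ such that $$ \sup_{p(x) \leq \cos( x \cdot \xi + \epsilon)\ \forall x\in\mathbb{R}^d} \int p \, d\mu \;<\; \inf_{q(x) \geq \cos( x \cdot \xi + \epsilon)\ \forall x\in\mathbb{R}^d} \int q \, d\mu,$$ where $p, q$ range over $\mathbb{R}[x_1, \ldots, x_d]$. Moreover, for fixed $\epsilon$, the set of $\xi \in \mathbb{R}^d\setminus\{0\}$ satisfying this strict inequality is open.
   Context: An admissible measure on a closed set $X \subseteq \mathbb{R}^d$ is a positive Radon measure $\mu$ supported on $X$ such that $\int_X |p|\,d\mu<\infty$ for every polynomial $p \in \mathbb{R}[x_1,\dots,x_d]$. Two admissible measures are moment equivalent if they give the same integral to every polynomial. $x\cdot\xi=\sum_j x_j\xi_j$ is the standard inner product. *)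

theory Defs
  imports "HOL-Analysis.Analysis"
begin

definition monomial_fun :: "('n::finite \<Rightarrow> nat) \<Rightarrow> real^'n \<Rightarrow> real" where
  "monomial_fun \<alpha> x = (\<Prod>i\<in>UNIV. (x $ i) ^ (\<alpha> i))"

definition poly_funs :: "(real^'n::finite \<Rightarrow> real) set" where
  "poly_funs = {p. \<exists>A c. finite A \<and> p = (\<lambda>x. \<Sum>\<alpha>\<in>A. c \<alpha> * monomial_fun \<alpha> x)}"

text \<open>Admissible measure on R^d: positive Radon (Borel, locally finite) measure
  such that every polynomial is integrable.\<close>
definition admissible :: "(real^'n::finite) measure \<Rightarrow> bool" where
  "admissible \<mu> \<longleftrightarrow> sets \<mu> = sets borel
     \<and> (\<forall>K. compact K \<longrightarrow> emeasure \<mu> K < \<infinity>)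
     \<and> (\<forall>p\<in>poly_funs. integrable \<mu> p)"

definition moment_equivalent :: "(real^'n::finite) measure \<Rightarrow> (real^'n) measure \<Rightarrow> bool" where
  "moment_equivalent \<mu> \<nu> \<longleftrightarrow> (\<forall>p\<in>poly_funs. integral\<^sup>L \<mu> p = integral\<^sup>L \<nu> p)"

definition lower_val :: "(real^'n::finite) measure \<Rightarrow> real^'n \<Rightarrow> real \<Rightarrow> real" where
  "lower_val \<mu> \<xi> \<epsilon> = Sup {integral\<^sup>L \<mu> p | p. p \<in> poly_funs \<and> (\<forall>x. p x \<le> cos (x \<bullet> \<xi> + \<epsilon>))}"

definition upper_val :: "(real^'n::finite) measure \<Rightarrow> real^'n \<Rightarrow> real \<Rightarrow> real" where
  "upper_val \<mu> \<xi> \<epsilon> = Inf {integral\<^sup>L \<mu> q | q. q \<in> poly_funs \<and> (\<forall>x. cos (x \<bullet> \<xi> + \<epsilon>) \<le> q x)}"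

end

theory Submission
  imports Defs "HOL-Probability.Probability" "HOL-Real_Asymp.Real_Asymp"
begin

text \<open>
  For fixed \<open>\<xi>\<close> and \<open>\<epsilon>\<close>, the strict inequality holds iff some admissible measure with the moments of
  \<open>\<mu>\<close> gives \<open>cos (x \<bullet> \<xi> + \<epsilon>)\<close> a different integral than \<open>\<mu>\<close> does. Everything follows from this: distinct
  finite measures have distinct Fourier transforms, and Fourier transforms are continuous in \<open>\<xi>\<close>.

  The nontrivial direction extends \<open>p \<mapsto> \<integral> p d\<mu>\<close> by Hahn--Banach to a positive functional \<open>\<Lambda>\<close> on all
  (not necessarily measurable) functions of polynomial growth, with the extreme value at the cosine.
  Indicator functions are then in the domain of \<open>\<Lambda>\<close>. Coding points of the compactification
  \<open>[-\<infinity>, \<infinity>]\<^sup>d\<close> by binary digits, \<open>\<Lambda>\<close> induces a finitely additive set function on the clopen subsets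
  of the Cantor space, which extends to a measure. Its image on \<open>[-\<infinity>, \<infinity>]\<^sup>d\<close> has no mass at infinity
  and represents \<open>\<Lambda>\<close> on continuous functions, since \<open>\<Lambda>\<close> is finite on all powers of \<open>1 + |x|\<^sup>2\<close>.
\<close>

subsection \<open>Polynomial functions\<close>

lemma monomial_funI: "(\<lambda>x. c * monomial_fun \<alpha> x) \<in> poly_funs"
  unfolding poly_funs_def by (auto intro!: exI[of _ "{\<alpha>}"] exI[of _ "\<lambda>_. c"])

lemma poly_funs_add:
  assumes "p \<in> poly_funs" "q \<in> poly_funs"
  shows "(\<lambda>x. p x + q x) \<in> poly_funs"
proof -
  obtain A c B d where A: "finite A" "p = (\<lambda>x. \<Sum>\<alpha>\<in>A. c \<alpha> * monomial_fun \<alpha> x)"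
    and B: "finite B" "q = (\<lambda>x. \<Sum>\<alpha>\<in>B. d \<alpha> * monomial_fun \<alpha> x)"
    using assms unfolding poly_funs_def by blast
  define e where "e \<alpha> = (if \<alpha> \<in> A then c \<alpha> else 0) + (if \<alpha> \<in> B then d \<alpha> else 0)" for \<alpha>
  have "p x + q x = (\<Sum>\<alpha>\<in>A \<union> B. e \<alpha> * monomial_fun \<alpha> x)" for x
  proof -
    have "p x = (\<Sum>\<alpha>\<in>A \<union> B. (if \<alpha> \<in> A then c \<alpha> else 0) * monomial_fun \<alpha> x)"
      unfolding A(2) by (rule sum.mono_neutral_cong_left) (use A B in auto)
    moreover have "q x = (\<Sum>\<alpha>\<in>A \<union> B. (if \<alpha> \<in> B then d \<alpha> else 0) * monomial_fun \<alpha> x)"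
      unfolding B(2) by (rule sum.mono_neutral_cong_left) (use A B in auto)
    ultimately show ?thesis
      by (simp add: e_def ring_distribs sum.distrib)
  qed
  then show ?thesis
    unfolding poly_funs_def using A(1) B(1) by (auto intro!: exI[of _ "A \<union> B"] exI[of _ e])
qed

lemma poly_funs_const: "(\<lambda>x. c) \<in> poly_funs"
  using monomial_funI[of c "\<lambda>_. 0"] by (simp add: monomial_fun_def)

lemma poly_funs_sum:
  "(\<And>i. i \<in> I \<Longrightarrow> f i \<in> poly_funs) \<Longrightarrow> (\<lambda>x. \<Sum>i\<in>I. f i x) \<in> poly_funs"
  by (induction I rule: infinite_finite_induct) (auto intro: poly_funs_add poly_funs_const)

lemma poly_funs_mult:
  assumes "p \<in> poly_funs" "q \<in> poly_funs"
  shows "(\<lambda>x. p x * q x) \<in> poly_funs"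
proof -
  obtain A c B d where A: "finite A" "p = (\<lambda>x. \<Sum>\<alpha>\<in>A. c \<alpha> * monomial_fun \<alpha> x)"
    and B: "finite B" "q = (\<lambda>x. \<Sum>\<alpha>\<in>B. d \<alpha> * monomial_fun \<alpha> x)"
    using assms unfolding poly_funs_def by blast
  \<comment> \<open>Different pairs of exponents may have the same sum, so no normal form is
    computed: closure under finite sums absorbs the repetitions.\<close>
  have "p x * q x = (\<Sum>\<alpha>\<in>A. \<Sum>\<beta>\<in>B. c \<alpha> * d \<beta> * monomial_fun (\<lambda>i. \<alpha> i + \<beta> i) x)" for x
    unfolding A(2) B(2) sum_product monomial_fun_def
    by (intro sum.cong refl) (simp add: power_add prod.distrib)
  then show ?thesis
    by (auto intro!: poly_funs_sum monomial_funI)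
qed

lemma poly_funs_cmult: "p \<in> poly_funs \<Longrightarrow> (\<lambda>x. c * p x) \<in> poly_funs"
  by (rule poly_funs_mult[OF poly_funs_const])

lemma poly_funs_uminus: "p \<in> poly_funs \<Longrightarrow> (\<lambda>x. - p x) \<in> poly_funs"
  using poly_funs_cmult[of p "-1"] by simp

lemma poly_funs_power: "p \<in> poly_funs \<Longrightarrow> (\<lambda>x. p x ^ k) \<in> poly_funs"
  by (induction k) (auto intro: poly_funs_const poly_funs_mult)

lemma poly_funs_coord: "(\<lambda>x. x $ i) \<in> poly_funs"
proof -
  have "(\<lambda>x. 1 * monomial_fun (\<lambda>j. if j = i then 1 else 0) x) = (\<lambda>x::real^'a. x $ i)"
    by (auto simp: monomial_fun_def if_distrib[of "\<lambda>n. _ ^ n"] cong: if_cong)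
  with monomial_funI show ?thesis by metis
qed

lemma poly_funs_continuous: "p \<in> poly_funs \<Longrightarrow> continuous_on UNIV p"
  unfolding poly_funs_def monomial_fun_def by (auto intro!: continuous_intros)

text \<open>This is 1 + |x|^2 in coordinates, so visibly a polynomial. Its powers dominate all
  polynomials, they increase with the exponent because the weight is at least 1, and moving
  coordinates towards 0 does not increase them.\<close>

definition weight :: "real^'n::finite \<Rightarrow> real" where
  "weight x = 1 + (\<Sum>i\<in>UNIV. (x $ i)\<^sup>2)"

lemma weight_ge_1: "1 \<le> weight x"
  by (simp add: weight_def sum_nonneg)

lemma weight_nonneg [simp]: "0 \<le> weight x"
  by (rule order_trans[OF zero_le_one weight_ge_1])

lemma weight_power_poly: "(\<lambda>x. weight x ^ k) \<in> poly_funs"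
  unfolding weight_def
  by (intro poly_funs_power poly_funs_add poly_funs_sum poly_funs_const poly_funs_coord)

lemma weight_mono:
  assumes "\<And>i. \<bar>x $ i\<bar> \<le> \<bar>y $ i\<bar>"
  shows "weight x \<le> weight y"
  unfolding weight_def using assms by (intro add_mono sum_mono) (auto simp: abs_le_square_iff)

lemma coord_le_weight: "1 + (x $ i)\<^sup>2 \<le> weight x"
  unfolding weight_def using member_le_sum[of i UNIV "\<lambda>i. (x $ i)\<^sup>2"] by simp

lemma monomial_fun_le_weight:
  "\<bar>monomial_fun \<alpha> x\<bar> \<le> weight x ^ (\<Sum>i\<in>UNIV. \<alpha> i)"
proof -
  have "\<bar>x $ i\<bar> \<le> weight x" for i
  proof -
    have "0 \<le> (\<bar>x $ i\<bar> - 1)\<^sup>2" by simp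
    then have "2 * \<bar>x $ i\<bar> \<le> 1 + (x $ i)\<^sup>2" by (simp add: power2_diff)
    with coord_le_weight[of x i] show ?thesis by linarith
  qed
  then have "(\<Prod>i\<in>UNIV. \<bar>x $ i\<bar> ^ \<alpha> i) \<le> (\<Prod>i\<in>UNIV. weight x ^ \<alpha> i)"
    by (intro prod_mono) (auto intro: power_mono)
  then show ?thesis
    by (simp add: monomial_fun_def abs_prod power_abs power_sum)
qed

lemma poly_funs_le_weight:
  assumes "p \<in> poly_funs"
  obtains C k where "C \<ge> 0" "\<And>x. \<bar>p x\<bar> \<le> C * weight x ^ k"
proof -
  obtain A c where A: "finite A" "p = (\<lambda>x. \<Sum>\<alpha>\<in>A. c \<alpha> * monomial_fun \<alpha> x)"
    using assms unfolding poly_funs_def by blast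
  define k where "k = (\<Sum>\<alpha>\<in>A. \<Sum>i\<in>UNIV. \<alpha> i)"
  have "\<bar>p x\<bar> \<le> (\<Sum>\<alpha>\<in>A. \<bar>c \<alpha>\<bar>) * weight x ^ k" for x
  proof -
    have "\<bar>monomial_fun \<alpha> x\<bar> \<le> weight x ^ k" if "\<alpha> \<in> A" for \<alpha>
    proof -
      have "(\<Sum>i\<in>UNIV. \<alpha> i) \<le> k"
        unfolding k_def using member_le_sum[OF that, of "\<lambda>\<alpha>. \<Sum>i\<in>UNIV. \<alpha> i"] A(1) by simp
      then show ?thesis
        using monomial_fun_le_weight[of \<alpha> x] power_increasing[OF _ weight_ge_1[of x]] by force
    qed
    then have "(\<Sum>\<alpha>\<in>A. \<bar>c \<alpha> * monomial_fun \<alpha> x\<bar>) \<le> (\<Sum>\<alpha>\<in>A. \<bar>c \<alpha>\<bar> * weight x ^ k)"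
      by (intro sum_mono) (auto simp: abs_mult intro: mult_left_mono)
    then show ?thesis
      unfolding A(2) sum_distrib_right
      using sum_abs[of "\<lambda>\<alpha>. c \<alpha> * monomial_fun \<alpha> x" A] by linarith
  qed
  then show ?thesis
    using that[of "\<Sum>\<alpha>\<in>A. \<bar>c \<alpha>\<bar>" k] by (simp add: sum_nonneg)
qed

text \<open>Only size is restricted, not measurability: this is the domain of the Hahn--Banach
  functional, and it has to contain indicators of sets defined through binary digits.\<close>

definition poly_growth :: "(real^'n::finite \<Rightarrow> real) set" where
  "poly_growth = {f. \<exists>p\<in>poly_funs. \<forall>x. \<bar>f x\<bar> \<le> p x}"

lemma poly_growth_le_weight:
  assumes "f \<in> poly_growth"
  obtains C k where "C \<ge> 0" "\<And>x. \<bar>f x\<bar> \<le> C * weight x ^ k"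
proof -
  obtain p where p: "p \<in> poly_funs" "\<And>x. \<bar>f x\<bar> \<le> p x"
    using assms by (auto simp: poly_growth_def)
  obtain C k where "C \<ge> 0" "\<And>x. \<bar>p x\<bar> \<le> C * weight x ^ k"
    using poly_funs_le_weight[OF p(1)] by blast
  then show ?thesis using that[of C k] p(2) by (meson abs_ge_self order_trans)
qed

lemma poly_growthI: "(\<And>x. \<bar>f x\<bar> \<le> C * weight x ^ k) \<Longrightarrow> f \<in> poly_growth"
  unfolding poly_growth_def
  by (auto intro!: bexI[of _ "\<lambda>x. C * weight x ^ k"] poly_funs_cmult weight_power_poly)

lemma bounded_poly_growth: "(\<And>x. \<bar>f x\<bar> \<le> C) \<Longrightarrow> f \<in> poly_growth"
  using poly_growthI[of f C 0] by simp

lemma poly_funs_subset_growth: "p \<in> poly_funs \<Longrightarrow> p \<in> poly_growth"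
  by (rule poly_funs_le_weight[of p]) (auto intro: poly_growthI)

subsection \<open>Hahn--Banach for sublinear functionals\<close>

definition fun_subspace :: "('a \<Rightarrow> real) set \<Rightarrow> bool" where
  "fun_subspace V \<longleftrightarrow> (\<lambda>_. 0) \<in> V \<and> (\<forall>f\<in>V. \<forall>g\<in>V. (\<lambda>x. f x + g x) \<in> V)
     \<and> (\<forall>f\<in>V. \<forall>c. (\<lambda>x. c * f x) \<in> V)"

definition sublinear_on :: "('a \<Rightarrow> real) set \<Rightarrow> (('a \<Rightarrow> real) \<Rightarrow> real) \<Rightarrow> bool" where
  "sublinear_on V P \<longleftrightarrow> (\<forall>f\<in>V. \<forall>g\<in>V. P (\<lambda>x. f x + g x) \<le> P f + P g)
     \<and> (\<forall>f\<in>V. \<forall>c\<ge>0. P (\<lambda>x. c * f x) = c * P f)"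

definition linear_on_funs :: "('a \<Rightarrow> real) set \<Rightarrow> (('a \<Rightarrow> real) \<Rightarrow> real) \<Rightarrow> bool" where
  "linear_on_funs V P \<longleftrightarrow> (\<forall>f\<in>V. \<forall>g\<in>V. P (\<lambda>x. f x + g x) = P f + P g)
     \<and> (\<forall>f\<in>V. \<forall>c. P (\<lambda>x. c * f x) = c * P f)"

lemma sublinear_on_add:
  "sublinear_on V P \<Longrightarrow> f \<in> V \<Longrightarrow> g \<in> V \<Longrightarrow> P (\<lambda>x. f x + g x) \<le> P f + P g"
  by (simp add: sublinear_on_def)

lemma sublinear_on_cmult:
  "sublinear_on V P \<Longrightarrow> f \<in> V \<Longrightarrow> c \<ge> 0 \<Longrightarrow> P (\<lambda>x. c * f x) = c * P f"
  by (simp add: sublinear_on_def)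

lemma linear_on_funs_add:
  "linear_on_funs V P \<Longrightarrow> f \<in> V \<Longrightarrow> g \<in> V \<Longrightarrow> P (\<lambda>x. f x + g x) = P f + P g"
  by (simp add: linear_on_funs_def)

lemma linear_on_funs_cmult:
  "linear_on_funs V P \<Longrightarrow> f \<in> V \<Longrightarrow> P (\<lambda>x. c * f x) = c * P f"
  by (simp add: linear_on_funs_def)

text \<open>Scaling by 1/c turns the inequality for c into its converse, and subadditivity at 0
  gives \<open>P 0 \<ge> 0\<close>. Functionals defined as infima, for which upper bounds are the
  natural ones, are thus easily seen to be sublinear.\<close>

lemma sublinear_onI:
  assumes V: "fun_subspace V"
    and add: "\<And>f g. f \<in> V \<Longrightarrow> g \<in> V \<Longrightarrow> P (\<lambda>x. f x + g x) \<le> P f + P g"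
    and zero: "P (\<lambda>x. 0) \<le> 0"
    and scale: "\<And>f c. f \<in> V \<Longrightarrow> c > 0 \<Longrightarrow> P (\<lambda>x. c * f x) \<le> c * P f"
  shows "sublinear_on V P"
proof -
  have "P (\<lambda>x. c * f x) = c * P f" if f: "f \<in> V" and c: "c \<ge> 0" for f c
  proof (cases "c = 0")
    case True
    have "0 \<le> P (\<lambda>x. 0)"
      using add[of "\<lambda>x. 0" "\<lambda>x. 0"] V by (simp add: fun_subspace_def)
    with zero True show ?thesis by simp
  next
    case False
    then have c: "c > 0" using c by simp
    have "P f \<le> inverse c * P (\<lambda>x. c * f x)"
      using scale[of "\<lambda>x. c * f x" "inverse c"] c f V
      by (simp add: fun_subspace_def mult.assoc[symmetric])
    then have "c * P f \<le> P (\<lambda>x. c * f x)"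
      using c by (simp add: field_simps)
    with scale[OF f c] show ?thesis by simp
  qed
  with add show ?thesis by (simp add: sublinear_on_def)
qed

lemma fun_subspace_add: "fun_subspace V \<Longrightarrow> f \<in> V \<Longrightarrow> g \<in> V \<Longrightarrow> (\<lambda>x. f x + g x) \<in> V"
  by (simp add: fun_subspace_def)

lemma fun_subspace_cmult: "fun_subspace V \<Longrightarrow> f \<in> V \<Longrightarrow> (\<lambda>x. c * f x) \<in> V"
  by (simp add: fun_subspace_def)

lemma fun_subspace_uminus: "fun_subspace V \<Longrightarrow> f \<in> V \<Longrightarrow> (\<lambda>x. - f x) \<in> V"
  using fun_subspace_cmult[of V f "-1"] by simp

lemma sublinear_on_zero: "fun_subspace V \<Longrightarrow> sublinear_on V P \<Longrightarrow> P (\<lambda>x. 0) = 0"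
  using sublinear_on_cmult[of V P "\<lambda>x. 0" 0] by (simp add: fun_subspace_def)

text \<open>Write g as (f + g) - f. With t * g in place of g this bounds P (f + t * g) - t * P g
  from below by - P (- f), uniformly in t \<ge> 0.\<close>

lemma sublinear_on_lower:
  assumes "fun_subspace V" "sublinear_on V P" "f \<in> V" "g \<in> V"
  shows "P g - P (\<lambda>x. - f x) \<le> P (\<lambda>x. f x + g x)"
proof -
  have "P (\<lambda>x. (f x + g x) + - f x) \<le> P (\<lambda>x. f x + g x) + P (\<lambda>x. - f x)"
    by (intro sublinear_on_add[OF assms(2)] fun_subspace_uminus[OF assms(1)]
        fun_subspace_add[OF assms(1)] assms(3,4))
  then show ?thesis by simp
qed

text \<open>The witness is the infimum of P (f + t * g) - t * P g over t \<ge> 0; t = 0 and t = 1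
  give the two bounds. The second one at f = - g forces every linear functional below Q to be at
  least P g at g.\<close>

lemma sublinear_shift:
  assumes V: "fun_subspace V" and P: "sublinear_on V P" and g: "g \<in> V"
  obtains Q where "sublinear_on V Q" "\<And>f. f \<in> V \<Longrightarrow> Q f \<le> P f"
    "\<And>f. f \<in> V \<Longrightarrow> Q f \<le> P (\<lambda>x. f x + g x) - P g"
proof -
  define S where "S f t = P (\<lambda>x. f x + t * g x) - t * P g" for f t
  define Q where "Q f = (INF t\<in>{0..}. S f t)" for f
  have lower: "- P (\<lambda>x. - f x) \<le> S f t" if "f \<in> V" "t \<ge> 0" for f t
  proof -
    have "P (\<lambda>x. t * g x) = t * P g"
      using P g that by (simp add: sublinear_on_def)
    then show ?thesis
      using sublinear_on_lower[OF V P that(1) fun_subspace_cmult[OF V g, of t]]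
      by (simp add: S_def)
  qed
  have bdd: "bdd_below (S f ` {0..})" if "f \<in> V" for f
    using lower[OF that] by (intro bdd_belowI2) auto
  have QS: "Q f \<le> S f t" if "f \<in> V" "t \<ge> 0" for f t
    unfolding Q_def using bdd[OF that(1)] that(2) by (intro cINF_lower) auto
  have "sublinear_on V Q"
  proof (rule sublinear_onI[OF V])
    show "Q (\<lambda>x. 0) \<le> 0"
      using QS[of "\<lambda>x. 0" 0] sublinear_on_zero[OF V P] V
      by (simp add: S_def fun_subspace_def)
  next
    fix f h assume f: "f \<in> V" and h: "h \<in> V"
    \<comment> \<open>Parameters add up: the expression for f + h at s + t splits into those for f
      at s and for h at t. The infima over s and t are then taken one after the other.\<close>
    have *: "Q (\<lambda>x. f x + h x) \<le> S f s + S h t" if "s \<ge> 0" "t \<ge> 0" for s t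
    proof -
      have "Q (\<lambda>x. f x + h x) \<le> S (\<lambda>x. f x + h x) (s + t)"
        using that fun_subspace_add[OF V f h] by (intro QS) auto
      also have "\<dots> = P (\<lambda>x. (f x + s * g x) + (h x + t * g x)) - (s + t) * P g"
        by (simp add: S_def algebra_simps)
      also have "\<dots> \<le> S f s + S h t"
      proof -
        have "(\<lambda>x. f x + s * g x) \<in> V" "(\<lambda>x. h x + t * g x) \<in> V"
          by (intro fun_subspace_add fun_subspace_cmult V f g h)+
        then have "P (\<lambda>x. (f x + s * g x) + (h x + t * g x))
            \<le> P (\<lambda>x. f x + s * g x) + P (\<lambda>x. h x + t * g x)"
          by (rule sublinear_on_add[OF P])
        then show ?thesis by (simp add: S_def algebra_simps)
      qed
      finally show ?thesis .
    qed
    have "Q (\<lambda>x. f x + h x) - S h t \<le> Q f" if "t \<ge> 0" for t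
      unfolding Q_def[of f] using *[OF _ that] by (intro cINF_greatest) (auto simp: algebra_simps)
    then have "Q (\<lambda>x. f x + h x) - Q f \<le> Q h"
      unfolding Q_def[of h] by (intro cINF_greatest) (auto simp: algebra_simps)
    then show "Q (\<lambda>x. f x + h x) \<le> Q f + Q h" by simp
  next
    fix f c assume f: "f \<in> V" and c: "(c::real) > 0"
    \<comment> \<open>Scaling f by c is compensated by scaling the parameter t by c.\<close>
    have "Q (\<lambda>x. c * f x) / c \<le> S f t" if "t \<ge> 0" for t
    proof -
      have "Q (\<lambda>x. c * f x) \<le> S (\<lambda>x. c * f x) (c * t)"
        using that c fun_subspace_cmult[OF V f] by (intro QS) auto
      also have "\<dots> = P (\<lambda>x. c * (f x + t * g x)) - c * t * P g"
        by (simp add: S_def algebra_simps)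
      also have "\<dots> = c * S f t"
      proof -
        have "(\<lambda>x. f x + t * g x) \<in> V"
          by (intro fun_subspace_add fun_subspace_cmult V f g)
        then have "P (\<lambda>x. c * (f x + t * g x)) = c * P (\<lambda>x. f x + t * g x)"
          using c by (intro sublinear_on_cmult[OF P]) auto
        then show ?thesis by (simp add: S_def algebra_simps)
      qed
      finally show ?thesis using c by (simp add: field_simps)
    qed
    then have "Q (\<lambda>x. c * f x) / c \<le> Q f"
      unfolding Q_def[of f] by (intro cINF_greatest) auto
    then show "Q (\<lambda>x. c * f x) \<le> c * Q f" using c by (simp add: field_simps)
  qed
  moreover have "Q f \<le> P f" "Q f \<le> P (\<lambda>x. f x + g x) - P g" if "f \<in> V" for f
    using QS[OF that, of 0] QS[OF that, of 1] by (simp_all add: S_def)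
  ultimately show ?thesis using that by blast
qed

text \<open>The shift of P along g lies below P, so it equals P by minimality, and its second bound
  becomes P f + P g \<le> P (f + g), the converse of subadditivity.\<close>

lemma sublinear_minimal_linear:
  assumes V: "fun_subspace V" and P: "sublinear_on V P"
    and minimal: "\<And>Q. sublinear_on V Q \<Longrightarrow> (\<And>f. f \<in> V \<Longrightarrow> Q f \<le> P f) \<Longrightarrow> \<forall>f\<in>V. Q f = P f"
  shows "linear_on_funs V P"
proof -
  have add: "P (\<lambda>x. f x + g x) = P f + P g" if f: "f \<in> V" and g: "g \<in> V" for f g
  proof -
    obtain Q where Q: "sublinear_on V Q" "\<And>f. f \<in> V \<Longrightarrow> Q f \<le> P f"
      "\<And>f. f \<in> V \<Longrightarrow> Q f \<le> P (\<lambda>x. f x + g x) - P g"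
      using sublinear_shift[OF V P g] by metis
    then have "P f \<le> P (\<lambda>x. f x + g x) - P g"
      using minimal[OF Q(1,2)] f by force
    moreover have "P (\<lambda>x. f x + g x) \<le> P f + P g"
      by (rule sublinear_on_add[OF P f g])
    ultimately show ?thesis by simp
  qed
  have "P (\<lambda>x. c * f x) = c * P f" if f: "f \<in> V" for f c
  proof (cases "c \<ge> 0")
    case True
    then show ?thesis using P f by (simp add: sublinear_on_def)
  next
    case False
    then have "P (\<lambda>x. - c * f x) = - c * P f"
      using False by (intro sublinear_on_cmult[OF P f]) simp
    moreover have "P (\<lambda>x. c * f x + - c * f x) = P (\<lambda>x. c * f x) + P (\<lambda>x. - c * f x)"
      by (intro add fun_subspace_cmult V f)
    ultimately show ?thesis using sublinear_on_zero[OF V P] by simp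
  qed
  with add show ?thesis by (simp add: linear_on_funs_def)
qed

text \<open>Zorn's lemma gives a minimal sublinear functional below P, and minimal ones are
  linear.\<close>

lemma sublinear_dominates_linear:
  assumes V: "fun_subspace V" and P: "sublinear_on V P"
  obtains \<Lambda> where "linear_on_funs V \<Lambda>" "\<And>f. f \<in> V \<Longrightarrow> \<Lambda> f \<le> P f"
proof -
  \<comment> \<open>Fixing the value 0 outside V makes functionals equal as soon as they agree on V,
    so that the pointwise order on total functions is the order wanted for minimality.\<close>
  define A where "A = {Q. sublinear_on V Q \<and> (\<forall>f\<in>V. Q f \<le> P f) \<and> (\<forall>f. f \<notin> V \<longrightarrow> Q f = 0)}"
  have restr: "(\<lambda>f. if f \<in> V then Q f else 0) \<in> A"
    if "sublinear_on V Q" "\<And>f. f \<in> V \<Longrightarrow> Q f \<le> P f" for Q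
    using that V by (auto simp: A_def sublinear_on_def fun_subspace_def)
  \<comment> \<open>The order is reversed, since Zorn's lemma is about maximal elements.\<close>
  have "\<exists>m\<in>A. \<forall>a\<in>A. a \<le> m \<longrightarrow> a = m"
  proof (rule predicate_Zorn)
    show "partial_order_on A (relation_of (\<lambda>x y. y \<le> x) A)"
      by (rule partial_order_on_relation_ofI) auto
  next
    fix C assume C: "C \<in> Chains (relation_of (\<lambda>x y. y \<le> x) A)"
    then have CA: "C \<subseteq> A" by (rule Chains_relation_of)
    have total: "Q \<le> Q' \<or> Q' \<le> Q" if "Q \<in> C" "Q' \<in> C" for Q Q'
      using C that by (auto simp: Chains_def relation_of_def)
    show "\<exists>u\<in>A. \<forall>a\<in>C. u \<le> a"
    proof (cases "C = {}")
      case True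
      then show ?thesis using restr[OF P] by auto
    next
      case False
      \<comment> \<open>The lower bound of a chain is its pointwise infimum, which is finite on V
        because every sublinear Q below P satisfies - P (- f) \<le> Q f.\<close>
      define M where "M f = (INF Q\<in>C. Q f)" for f
      have lower: "- P (\<lambda>x. - f x) \<le> Q f" if "f \<in> V" "Q \<in> C" for f Q
      proof -
        have Q: "sublinear_on V Q" "\<And>f. f \<in> V \<Longrightarrow> Q f \<le> P f"
          using that CA by (auto simp: A_def)
        have z: "(\<lambda>x. 0) \<in> V" using V by (simp add: fun_subspace_def)
        have "- Q (\<lambda>x. - f x) \<le> Q f"
          using sublinear_on_lower[OF V Q(1) that(1) z] sublinear_on_zero[OF V Q(1)] by simp
        moreover have "Q (\<lambda>x. - f x) \<le> P (\<lambda>x. - f x)"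
          using Q(2) fun_subspace_uminus[OF V that(1)] by simp
        ultimately show ?thesis by simp
      qed
      have out: "Q f = 0" if "f \<notin> V" "Q \<in> C" for f Q
        using CA that by (auto simp: A_def)
      have bdd: "bdd_below ((\<lambda>Q. Q f) ` C)" for f
      proof (cases "f \<in> V")
        case True
        then show ?thesis using lower by (intro bdd_belowI2) auto
      next
        case False
        then show ?thesis using out[of f] by (intro bdd_belowI2[where m=0]) (metis order_refl)
      qed
      have MQ: "M f \<le> Q f" if "Q \<in> C" for f Q
        unfolding M_def using bdd that by (intro cINF_lower) auto
      have "sublinear_on V M"
      proof (rule sublinear_onI[OF V])
        obtain Q where "Q \<in> C" using False by auto
        then show "M (\<lambda>x. 0) \<le> 0"
          using MQ[of Q "\<lambda>x. 0"] CA sublinear_on_zero[OF V, of Q] by (auto simp: A_def)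
      next
        fix f h assume f: "f \<in> V" and h: "h \<in> V"
        have *: "M (\<lambda>x. f x + h x) \<le> Q f + Q' h" if Q: "Q \<in> C" and Q': "Q' \<in> C" for Q Q'
        proof -
          \<comment> \<open>Of two members of a chain the smaller one serves for both
            summands.\<close>
          obtain Q'' where Q'': "Q'' \<in> C" "Q'' \<le> Q" "Q'' \<le> Q'"
            using total[OF Q Q'] Q Q' by auto
          have "M (\<lambda>x. f x + h x) \<le> Q'' (\<lambda>x. f x + h x)" using MQ Q''(1) by simp
          also have "\<dots> \<le> Q'' f + Q'' h"
            using Q''(1) CA f h by (auto simp: A_def sublinear_on_def)
          also have "\<dots> \<le> Q f + Q' h" using Q''(2,3) by (intro add_mono) (auto simp: le_fun_def)
          finally show ?thesis .
        qed
        have "M (\<lambda>x. f x + h x) - Q' h \<le> M f" if "Q' \<in> C" for Q'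
          unfolding M_def[of f] using *[OF _ that] False
          by (intro cINF_greatest) (auto simp: algebra_simps)
        then have "M (\<lambda>x. f x + h x) - M f \<le> M h"
          unfolding M_def[of h] using False by (intro cINF_greatest) (auto simp: algebra_simps)
        then show "M (\<lambda>x. f x + h x) \<le> M f + M h" by simp
      next
        fix f c assume f: "f \<in> V" and c: "(c::real) > 0"
        have "M (\<lambda>x. c * f x) / c \<le> Q f" if "Q \<in> C" for Q
        proof -
          have "sublinear_on V Q" using CA that by (auto simp: A_def)
          then have "Q (\<lambda>x. c * f x) = c * Q f"
            using f c by (simp add: sublinear_on_def)
          then show ?thesis
            using MQ[OF that, of "\<lambda>x. c * f x"] c by (simp add: field_simps)
        qed
        then have "M (\<lambda>x. c * f x) / c \<le> M f"
          unfolding M_def[of f] using False by (intro cINF_greatest) auto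
        then show "M (\<lambda>x. c * f x) \<le> c * M f" using c by (simp add: field_simps)
      qed
      moreover obtain Q0 where "Q0 \<in> C" using False by auto
      then have "M f \<le> P f" if "f \<in> V" for f
        using MQ[of Q0 f] CA that by (force simp: A_def)
      moreover have "M f = 0" if "f \<notin> V" for f
      proof -
        have "(\<lambda>Q. Q f) ` C = {0}" using out[OF that] False by force
        then show ?thesis by (simp add: M_def)
      qed
      ultimately have "M \<in> A" by (simp add: A_def)
      moreover have "\<forall>a\<in>C. M \<le> a" using MQ by (auto simp: le_fun_def)
      ultimately show ?thesis by blast
    qed
  qed
  then obtain m where m: "m \<in> A" "\<And>a. a \<in> A \<Longrightarrow> a \<le> m \<Longrightarrow> a = m" by blast
  have "linear_on_funs V m"
  proof (rule sublinear_minimal_linear[OF V])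
    show "sublinear_on V m" using m(1) by (simp add: A_def)
    fix Q assume Q: "sublinear_on V Q" "\<And>f. f \<in> V \<Longrightarrow> Q f \<le> m f"
    let ?Q = "\<lambda>f. if f \<in> V then Q f else 0"
    have "?Q \<in> A"
      using restr[OF Q(1)] Q(2) m(1) by (force simp: A_def)
    moreover have "?Q \<le> m"
      using Q(2) m(1) by (auto simp: le_fun_def A_def)
    ultimately have eq: "?Q = m" by (rule m(2))
    show "\<forall>f\<in>V. Q f = m f"
    proof
      fix f assume "f \<in> V"
      then show "Q f = m f" using fun_cong[OF eq, of f] by simp
    qed
  qed
  then show ?thesis using that[of m] m(1) by (auto simp: A_def)
qed

text \<open>Dominating the shift of P along g instead of P itself yields equality at g. No
  functional on a subspace is prescribed: agreement with the integral on polynomials will follow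
  from domination applied to p and - p.\<close>

theorem Hahn_Banach_sublinear:
  assumes V: "fun_subspace V" and P: "sublinear_on V P" and g: "g \<in> V"
  obtains \<Lambda> where "linear_on_funs V \<Lambda>" "\<And>f. f \<in> V \<Longrightarrow> \<Lambda> f \<le> P f" "\<Lambda> g = P g"
proof -
  obtain Q where Q: "sublinear_on V Q" "\<And>f. f \<in> V \<Longrightarrow> Q f \<le> P f"
    "\<And>f. f \<in> V \<Longrightarrow> Q f \<le> P (\<lambda>x. f x + g x) - P g"
    using sublinear_shift[OF V P g] by metis
  obtain \<Lambda> where \<Lambda>: "linear_on_funs V \<Lambda>" "\<And>f. f \<in> V \<Longrightarrow> \<Lambda> f \<le> Q f"
    using sublinear_dominates_linear[OF V Q(1)] by blast
  have mg: "(\<lambda>x. - g x) \<in> V" by (rule fun_subspace_uminus[OF V g])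
  have "\<Lambda> (\<lambda>x. -1 * g x) = -1 * \<Lambda> g"
    by (rule linear_on_funs_cmult[OF \<Lambda>(1) g])
  then have "- \<Lambda> g = \<Lambda> (\<lambda>x. - g x)" by simp
  also have "\<dots> \<le> - P g"
    using \<Lambda>(2)[OF mg] Q(3)[OF mg] sublinear_on_zero[OF V P] by simp
  finally have "P g \<le> \<Lambda> g" by simp
  moreover have "\<Lambda> f \<le> P f" if "f \<in> V" for f
    using \<Lambda>(2)[OF that] Q(2)[OF that] by simp
  ultimately show ?thesis using that[OF \<Lambda>(1)] g by (metis order_antisym)
qed

subsection \<open>Uniqueness of Fourier transforms\<close>

text \<open>The characteristic function at 0 is the total mass. If it vanishes, both measures are
  zero; otherwise normalising reduces to Levy's uniqueness theorem for probability measures.\<close>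

lemma finite_measure_char_eqI:
  fixes M N :: "real measure"
  assumes "finite_measure M" "finite_measure N" "sets M = sets borel" "sets N = sets borel"
    and char: "\<And>t. char M t = char N t"
  shows "M = N"
proof -
  interpret M: finite_measure M by fact
  interpret N: finite_measure N by fact
  have [measurable_cong]: "sets M = sets borel" "sets N = sets borel" by fact+
  have sp: "space M = UNIV" "space N = UNIV"
    using assms(3,4)[THEN sets_eq_imp_space_eq] by simp_all
  define c where "c = measure M UNIV"
  have cN: "c = measure N UNIV"
    using char[of 0] by (simp add: char_def c_def sp)
  have emM: "emeasure M UNIV = ennreal c" and emN: "emeasure N UNIV = ennreal c"
    using M.emeasure_eq_measure[of UNIV] N.emeasure_eq_measure[of UNIV] by (simp_all add: c_def cN[symmetric] flip: c_def)
  show ?thesis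
  proof (cases "c = 0")
    case True
    show ?thesis
    proof (rule measure_eqI)
      fix A assume "A \<in> sets M"
      have "emeasure M A \<le> emeasure M UNIV" "emeasure N A \<le> emeasure N UNIV"
        by (auto intro!: emeasure_mono simp: assms)
      then show "emeasure M A = emeasure N A" using True emM emN by simp
    qed (use assms in simp)
  next
    case False
    then have c: "c > 0" using measure_nonneg[of M UNIV] unfolding c_def by linarith
    define M' where "M' = density M (\<lambda>_. ennreal (1 / c))"
    define N' where "N' = density N (\<lambda>_. ennreal (1 / c))"
    have em: "emeasure M' A = ennreal (1/c) * emeasure M A"
      "emeasure N' A = ennreal (1/c) * emeasure N A" if "A \<in> sets borel" for A
      using that by (auto simp: M'_def N'_def emeasure_density_const assms)
    have one: "ennreal (1/c) * ennreal c = 1"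
      using c by (simp flip: ennreal_mult')
    have "real_distribution M'"
    proof (intro real_distribution.intro real_distribution_axioms.intro prob_spaceI)
      show "emeasure M' (space M') = 1"
        using em(1)[of UNIV] emM one by (simp add: M'_def sp)
    qed (simp add: M'_def assms)
    moreover have "real_distribution N'"
    proof (intro real_distribution.intro real_distribution_axioms.intro prob_spaceI)
      show "emeasure N' (space N') = 1"
        using em(2)[of UNIV] emN one by (simp add: N'_def sp)
    qed (simp add: N'_def assms)
    moreover have "char M' = char N'"
    proof
      fix t
      show "char M' t = char N' t"
        using char[of t] c unfolding char_def M'_def N'_def
        by (subst (1 2) integral_density) auto
    qed
    ultimately have eq: "M' = N'" by (rule Levy_uniqueness)
    show ?thesis
    proof (rule measure_eqI)
      fix A assume "A \<in> sets M"
      then have A: "A \<in> sets borel" using assms by simp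
      have "ennreal c * (ennreal (1/c) * emeasure M A) = ennreal c * (ennreal (1/c) * emeasure N A)"
        using em[OF A] eq by simp
      then show "emeasure M A = emeasure N A"
        using one by (simp add: mult.assoc[symmetric] mult.commute[of "ennreal c"])
    qed (use assms in simp)
  qed
qed

text \<open>The two sides of \<open>eq\<close> are the characteristic functions of the images under
  the j-th coordinate of the measures with density w. Nonnegativity and boundedness of w make these
  finite measures on the line, where uniqueness applies.\<close>

lemma marginal_density_eqI:
  fixes M N :: "(real^'n::finite) measure" and w :: "real^'n \<Rightarrow> real"
  assumes "finite_measure M" "finite_measure N" "sets M = sets borel" "sets N = sets borel"
    and w[measurable]: "w \<in> borel_measurable borel" and w0: "\<And>x. 0 \<le> w x" and wB: "\<And>x. w x \<le> B"
    and eq: "\<And>t. (CLINT x|M. cis (t * x $ j) * w x) = (CLINT x|N. cis (t * x $ j) * w x)"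
    and A[measurable]: "A \<in> sets borel"
  shows "(LINT x|M. w x * indicator A (x $ j)) = (LINT x|N. w x * indicator A (x $ j))"
proof -
  have [measurable_cong]: "sets M = sets borel" "sets N = sets borel" by fact+
  define D where "D L = distr (density L (\<lambda>x. ennreal (w x))) borel (\<lambda>x. x $ j)" for L
  have fin: "finite_measure (D L)" if "finite_measure L" "sets L = sets borel" for L
  proof -
    interpret finite_measure L by fact
    have [measurable_cong]: "sets L = sets borel" by fact
    have "emeasure (D L) (space (D L)) = (\<integral>\<^sup>+x. ennreal (w x) \<partial>L)"
      unfolding D_def by (subst emeasure_distr) (auto simp: emeasure_density intro!: nn_integral_cong)
    also have "\<dots> \<le> (\<integral>\<^sup>+x. ennreal B \<partial>L)"
      using wB by (intro nn_integral_mono ennreal_leI)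
    also have "\<dots> < \<infinity>" by (simp add: ennreal_mult_eq_top_iff less_top[symmetric])
    finally show ?thesis by (intro finite_measureI) auto
  qed
  have int: "(LINT y|D L. h y) = (LINT x|L. w x *\<^sub>R h (x $ j))"
    if "sets L = sets borel" and [measurable]: "h \<in> borel_measurable borel"
    for L and h :: "real \<Rightarrow> 'b::{banach, second_countable_topology}"
  proof -
    have [measurable_cong]: "sets L = sets borel" by fact
    show ?thesis unfolding D_def using w0 by (subst integral_distr; simp add: integral_density)
  qed
  have "char (D L) t = (CLINT x|L. cis (t * x $ j) * w x)" if "sets L = sets borel" for L t
    unfolding char_def by (subst int[OF that]) (auto simp: cis_conv_exp scaleR_conv_of_real mult.commute)
  then have "char (D M) t = char (D N) t" for t
    using eq assms by simp
  then have DD: "D M = D N"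
    using assms by (intro finite_measure_char_eqI fin) (simp_all add: D_def)
  have "(LINT x|L. w x * indicator A (x $ j)) = (LINT y|D L. indicator A y)" if "sets L = sets borel" for L
    by (subst int[OF that]) auto
  then show ?thesis using DD assms by simp
qed

lemma inner_axis_vec: "(x::real^'n::finite) \<bullet> axis j t = t * x $ j"
  by (simp add: inner_axis mult.commute)

text \<open>Reduction to dimension one: by induction, one coordinate at a time acquires an indicator
  \<open>A i\<close> next to the exponential, each time by uniqueness for a one-dimensional
  marginal. Finally the measures agree on boxes.\<close>

theorem finite_measure_eqI_Fourier:
  fixes M N :: "(real^'n::finite) measure"
  assumes "finite_measure M" "finite_measure N" "sets M = sets borel" "sets N = sets borel"
    and Fourier: "\<And>\<xi>. (CLINT x|M. cis (x \<bullet> \<xi>)) = (CLINT x|N. cis (x \<bullet> \<xi>))"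
  shows "M = N"
proof -
  interpret M: finite_measure M by fact
  interpret N: finite_measure N by fact
  have [measurable_cong]: "sets M = sets borel" "sets N = sets borel" by fact+
  define E :: "(real^'n \<Rightarrow> complex) \<Rightarrow> bool" where
    "E f \<longleftrightarrow> integrable M f \<and> integrable N f \<and> integral\<^sup>L M f = integral\<^sup>L N f" for f
  have E_add: "E (\<lambda>x. f x + g x)" if "E f" "E g" for f g
    using that by (auto simp: E_def)
  have E_cmult: "E (\<lambda>x. c * f x)" if "E f" for f c
    using that by (auto simp: E_def)
  have E_I: "E f" if "integral\<^sup>L M f = integral\<^sup>L N f" "f \<in> borel_measurable borel" "\<And>x. norm (f x) \<le> B" for f B
    using that by (auto simp: E_def intro!: M.integrable_const_bound[of _ B] N.integrable_const_bound[of _ B])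
  have [measurable]: "(\<lambda>x::real^'n. cis (x \<bullet> \<xi>)) \<in> borel_measurable borel" for \<xi>
    unfolding cis_conv_exp by measurable
  define S where "S I A = {x::real^'n. \<forall>i\<in>I. x $ i \<in> A i}" for I A
  have S[measurable]: "S I A \<in> sets borel" if "\<And>i. A i \<in> sets borel" for I A
  proof -
    have [measurable]: "A i \<in> sets borel" for i by fact
    show ?thesis unfolding S_def by measurable
  qed
  \<comment> \<open>The exponential stays in the claim, for all frequencies, because the next
    coordinate needs the Fourier transform in that coordinate of what has been obtained so
    far.\<close>
  have main: "E (\<lambda>x. cis (x \<bullet> \<xi>) * indicator (S I A) x)"
    if "finite I" "\<And>i. A i \<in> sets borel" for I A \<xi>
    using that
  proof (induction I arbitrary: \<xi> rule: finite_induct)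
    case empty
    show ?case
      using Fourier[of \<xi>] by (intro E_I[where B=1]) (auto simp: S_def)
  next
    case (insert j I)
    note IH = insert.IH[OF insert.prems]
    note [measurable] = S[OF insert.prems, of I] insert.prems
    \<comment> \<open>Densities must be nonnegative, so the complex exponential cannot serve as w.
      The weights 1, 1 + cos and 1 + sin, all between 0 and 2, are used instead and recombined into
      \<open>cis\<close> afterwards.\<close>
    have step: "E (\<lambda>x. complex_of_real (w x * indicator (S I A) x * indicator (A j) (x $ j)))"
      if [measurable]: "w \<in> borel_measurable borel" and w: "\<And>x. 0 \<le> w x" "\<And>x. w x \<le> 2"
        and Ew: "\<And>t. E (\<lambda>x. cis (t * x $ j) * w x * indicator (S I A) x)" for w
    proof (rule E_I[where B=2])
      have "(LINT x|M. (w x * indicator (S I A) x) * indicator (A j) (x $ j))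
        = (LINT x|N. (w x * indicator (S I A) x) * indicator (A j) (x $ j))"
      proof (rule marginal_density_eqI[where B=2])
        show "w x * indicator (S I A) x \<le> 2" for x
          using w by (auto simp: indicator_def)
        show "(CLINT x|M. cis (t * x $ j) * complex_of_real (w x * indicator (S I A) x)) =
          (CLINT x|N. cis (t * x $ j) * complex_of_real (w x * indicator (S I A) x))" for t
          using Ew[of t] by (simp add: E_def mult.assoc of_real_indicator)
      qed (use assms w in \<open>auto\<close>)
      then show "(CLINT x|M. complex_of_real (w x * indicator (S I A) x * indicator (A j) (x $ j)))
        = (CLINT x|N. complex_of_real (w x * indicator (S I A) x * indicator (A j) (x $ j)))"
        by (simp only: integral_complex_of_real)
    qed (use w in \<open>auto simp: indicator_def norm_mult\<close>)
    have cis_shift: "cis (t * x $ j) * cis (x \<bullet> \<eta>) = cis (x \<bullet> (axis j t + \<eta>))" for t x \<eta>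
      by (simp add: cis_mult inner_add_right inner_axis_vec)
    have IH': "E (\<lambda>x. cis (t * x $ j) * cis (x \<bullet> \<eta>) * indicator (S I A) x)" for t \<eta>
      unfolding cis_shift by (rule IH)
    have 1: "E (\<lambda>x. complex_of_real (1 * indicator (S I A) x * indicator (A j) (x $ j)))"
      by (rule step) (use IH'[of _ 0] in auto)
    have 2: "E (\<lambda>x. complex_of_real ((1 + cos (x \<bullet> \<xi>)) * indicator (S I A) x * indicator (A j) (x $ j)))"
    proof (rule step)
      fix t
      \<comment> \<open>Euler's formula expresses the weight by exponentials of frequencies 0, \<xi>
        and - \<xi>, to which the induction hypothesis applies.\<close>
      have cos: "complex_of_real (1 + cos (x \<bullet> \<xi>)) = cis (x \<bullet> 0) + (1/2) * cis (x \<bullet> \<xi>) + (1/2) * cis (x \<bullet> (-\<xi>))" for x :: "real^'n"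
        by (simp add: complex_eq_iff)
      have "E (\<lambda>x. cis (t * x $ j) * cis (x \<bullet> 0) * indicator (S I A) x
         + (1/2) * (cis (t * x $ j) * cis (x \<bullet> \<xi>) * indicator (S I A) x)
         + (1/2) * (cis (t * x $ j) * cis (x \<bullet> (-\<xi>)) * indicator (S I A) x))"
        by (intro E_add E_cmult IH')
      then show "E (\<lambda>x. cis (t * x $ j) * complex_of_real (1 + cos (x \<bullet> \<xi>)) * indicator (S I A) x)"
        unfolding cos by (simp add: algebra_simps)
    qed (auto simp: real_0_le_add_iff)
    have 3: "E (\<lambda>x. complex_of_real ((1 + sin (x \<bullet> \<xi>)) * indicator (S I A) x * indicator (A j) (x $ j)))"
    proof (rule step)
      fix t
      have sin: "complex_of_real (1 + sin (x \<bullet> \<xi>)) = cis (x \<bullet> 0) + (-\<i>/2) * cis (x \<bullet> \<xi>) + (\<i>/2) * cis (x \<bullet> (-\<xi>))" for x :: "real^'n"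
        by (simp add: complex_eq_iff)
      have "E (\<lambda>x. cis (t * x $ j) * cis (x \<bullet> 0) * indicator (S I A) x
         + (-\<i>/2) * (cis (t * x $ j) * cis (x \<bullet> \<xi>) * indicator (S I A) x)
         + (\<i>/2) * (cis (t * x $ j) * cis (x \<bullet> (-\<xi>)) * indicator (S I A) x))"
        by (intro E_add E_cmult IH')
      then show "E (\<lambda>x. cis (t * x $ j) * complex_of_real (1 + sin (x \<bullet> \<xi>)) * indicator (S I A) x)"
        unfolding sin by (simp add: algebra_simps)
    qed (auto simp: real_0_le_add_iff)
    \<comment> \<open>Here cis = (1 + cos) + i (1 + sin) - (1 + i).\<close>
    have "E (\<lambda>x. complex_of_real ((1 + cos (x \<bullet> \<xi>)) * indicator (S I A) x * indicator (A j) (x $ j))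
      + \<i> * complex_of_real ((1 + sin (x \<bullet> \<xi>)) * indicator (S I A) x * indicator (A j) (x $ j))
      + (- 1 - \<i>) * complex_of_real (1 * indicator (S I A) x * indicator (A j) (x $ j)))"
      by (intro E_add E_cmult 1 2 3)
    also have "(\<lambda>x. complex_of_real ((1 + cos (x \<bullet> \<xi>)) * indicator (S I A) x * indicator (A j) (x $ j))
      + \<i> * complex_of_real ((1 + sin (x \<bullet> \<xi>)) * indicator (S I A) x * indicator (A j) (x $ j))
      + (- 1 - \<i>) * complex_of_real (1 * indicator (S I A) x * indicator (A j) (x $ j)))
      = (\<lambda>x. cis (x \<bullet> \<xi>) * indicator (S (insert j I) A) x)"
      by (rule ext) (auto simp: complex_eq_iff indicator_def S_def)
    finally show ?case .
  qed
  \<comment> \<open>Frequency 0 and all coordinates leave just the indicator of a box.\<close>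
  have box: "emeasure M (box a b) = emeasure N (box a b)" for a b
  proof -
    have "box a b = S UNIV (\<lambda>i. {a $ i <..< b $ i})"
      by (auto simp: S_def mem_box_cart)
    then have "E (indicator (box a b))"
      using main[of UNIV "\<lambda>i. {a $ i <..< b $ i}" 0] by simp
    then have "(CLINT x|M. complex_of_real (indicator (box a b) x)) = (CLINT x|N. complex_of_real (indicator (box a b) x))"
      by (simp add: E_def of_real_indicator)
    then have "measure M (box a b) = measure N (box a b)"
      by (simp only: integral_complex_of_real of_real_eq_iff) (simp add: assms)
    then show ?thesis
      by (simp add: M.emeasure_eq_measure N.emeasure_eq_measure)
  qed
  show ?thesis
  proof (rule measure_eqI_generator_eq[where \<Omega>=UNIV and E="range (\<lambda>(a, b). box a b)"
        and A="\<lambda>n. box (- (\<chi> i. real n)) (\<chi> i. real n)"])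
    show "Int_stable (range (\<lambda>(a, b). box a b :: (real^'n) set))"
      by (auto simp: Int_stable_def box_Int_box)
    show "sets M = sigma_sets UNIV (range (\<lambda>(a, b). box a b))" "sets N = sigma_sets UNIV (range (\<lambda>(a, b). box a b))"
      by (simp_all add: assms borel_eq_box)
    show "(\<Union>n. box (- (\<chi> i. real n)) (\<chi> i. real n)) = (UNIV :: (real^'n) set)"
    proof (intro set_eqI iffI UNIV_I)
      fix x :: "real^'n"
      obtain n where n: "norm x < real n" using reals_Archimedean2 by blast
      have "\<bar>x $ i\<bar> < real n" for i using component_le_norm_cart[of x i] n by linarith
      then have "x \<in> box (- (\<chi> i. real n)) (\<chi> i. real n)"
        by (auto simp: mem_box_cart abs_less_iff minus_less_iff)
      then show "x \<in> (\<Union>n. box (- (\<chi> i. real n)) (\<chi> i. real n))" by blast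
    qed
  qed (auto simp: box)
qed

subsection \<open>Finitely additive set functions on the Cantor space\<close>

text \<open>Tychonoff's theorem for the finite discrete space \<open>bool\<close>.\<close>

lemma compact_Cantor: "compact (UNIV :: ('i \<Rightarrow> bool) set)"
proof -
  have "compact_space (product_topology (\<lambda>i::'i. euclidean :: bool topology) UNIV)"
    unfolding compact_space_product_topology by (simp add: compact_space_def finite_imp_compact)
  then show ?thesis
    by (simp add: euclidean_product_topology compact_space_def)
qed

definition clopens :: "'a::topological_space set set" where
  "clopens = {A. open A \<and> closed A}"

lemma algebra_clopens: "algebra UNIV (clopens :: 'a::topological_space set set)"
  unfolding algebra_iff_Un by (auto simp: clopens_def)

lemma clopen_coordinate: "{u :: 'i \<Rightarrow> bool. u p} \<in> clopens"
proof -
  have c: "continuous_on UNIV (\<lambda>u :: 'i \<Rightarrow> bool. u p)" by simp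
  have "(\<lambda>u :: 'i \<Rightarrow> bool. u p) -` {True} = {u. u p}" by auto
  then show ?thesis
    using open_vimage[OF Topological_Spaces.open_discrete[of "{True}"] c] closed_vimage[OF closed_singleton[of True] c]
    by (simp add: clopens_def)
qed

text \<open>The complement of a fibre is the preimage of the finitely many other values, hence
  closed.\<close>

lemma clopen_level_set:
  fixes F :: "'a::topological_space \<Rightarrow> 'b::t1_space"
  assumes c: "continuous_on UNIV F" and fin: "finite (range F)"
  shows "F -` {v} \<in> clopens"
proof -
  have "F -` {v} = - (F -` (range F - {v}))" by auto
  moreover have "closed (F -` (range F - {v}))"
    using fin by (intro closed_vimage c finite_imp_closed) auto
  moreover have "closed (F -` {v})" by (intro closed_vimage c) auto
  ultimately show ?thesis by (metis (no_types, lifting) clopens_def mem_Collect_eq open_Compl)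
qed

text \<open>By compactness a decreasing sequence of clopen sets with empty intersection is eventually
  empty, so finite additivity already gives countable additivity.\<close>

lemma Cantor_measure:
  fixes m :: "('i \<Rightarrow> bool) set \<Rightarrow> real"
  assumes pos: "\<And>A. 0 \<le> m A"
    and add: "\<And>A B. A \<inter> B = {} \<Longrightarrow> m (A \<union> B) = m A + m B"
  obtains M where "sets M = sigma_sets UNIV clopens" "finite_measure M"
    "\<And>A. A \<in> clopens \<Longrightarrow> measure M A = m A"
proof -
  interpret algebra UNIV "clopens :: ('i \<Rightarrow> bool) set set" by (rule algebra_clopens)
  have m0: "m {} = 0" using add[of "{}" "{}"] by simp
  have "\<exists>\<mu>. (\<forall>s\<in>clopens. \<mu> s = ennreal (m s)) \<and> measure_space UNIV (sigma_sets UNIV clopens) \<mu>"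
  proof (rule caratheodory_empty_continuous)
    show "positive clopens (\<lambda>A. ennreal (m A))" by (simp add: positive_def m0)
    show "additive clopens (\<lambda>A. ennreal (m A))"
      by (auto simp: additive_def add pos ennreal_plus)
    fix A :: "nat \<Rightarrow> ('i \<Rightarrow> bool) set"
    assume A: "range A \<subseteq> clopens" and dec: "decseq A" and empty: "(\<Inter>i. A i) = {}"
    have "\<exists>C'\<subseteq>UNIV. finite C' \<and> (UNIV :: ('i \<Rightarrow> bool) set) \<subseteq> (\<Union>n\<in>C'. - A n)"
    proof (rule compactE_image[OF compact_Cantor, of UNIV "\<lambda>n. - A n"])
      show "open (- A n)" for n using A by (auto simp: clopens_def)
      show "UNIV \<subseteq> (\<Union>n. - A n)" using empty by blast
    qed blast
    then obtain C where C: "finite C" "(UNIV :: ('i \<Rightarrow> bool) set) \<subseteq> (\<Union>n\<in>C. - A n)" by blast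
    \<comment> \<open>The inserted 0 only makes the maximum meaningful for empty C.\<close>
    have "A n = {}" if n: "n \<ge> Max (insert 0 C)" for n
    proof -
      have "A n \<subseteq> A k" if "k \<in> C" for k
        using that C(1) n by (intro decseqD[OF dec]) auto
      then show ?thesis using C(2) by blast
    qed
    then have "eventually (\<lambda>n. ennreal (m (A n)) = 0) sequentially"
      unfolding eventually_sequentially by (metis m0 ennreal_0)
    then show "(\<lambda>i. ennreal (m (A i))) \<longlonglongrightarrow> 0" by (rule tendsto_eventually)
  qed auto
  then obtain \<mu> where \<mu>: "\<And>s. s \<in> clopens \<Longrightarrow> \<mu> s = ennreal (m s)"
    "measure_space UNIV (sigma_sets UNIV clopens) \<mu>" by blast
  define M where "M = measure_of UNIV clopens \<mu>"
  have sets: "sets M = sigma_sets UNIV clopens" unfolding M_def by simp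
  have em: "emeasure M A = ennreal (m A)" if "A \<in> clopens" for A
  proof -
    have "emeasure M A = \<mu> A"
    proof (rule emeasure_measure_of[OF M_def])
      show "A \<in> sets M" using that sets by auto
    qed (use \<mu>(2) sets in \<open>auto simp: measure_space_def\<close>)
    then show ?thesis using \<mu>(1) that by simp
  qed
  have "finite_measure M"
  proof (rule finite_measureI)
    have "space M = UNIV" unfolding M_def by (simp add: space_measure_of_conv)
    then show "emeasure M (space M) \<noteq> \<infinity>" using em[of UNIV] by (auto simp: clopens_def)
  qed
  moreover have "measure M A = m A" if "A \<in> clopens" for A
    using em[OF that] pos by (simp add: measure_def)
  ultimately show ?thesis using that sets by blast
qed

subsection \<open>Binary digits\<close>

text \<open>For y in [0, 1) this is the binary digit of weight 2^-(k+1); dyadic numbers get their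
  terminating expansion.\<close>

definition digit :: "real \<Rightarrow> nat \<Rightarrow> bool" where
  "digit y k = odd \<lfloor>2 ^ Suc k * y\<rfloor>"

text \<open>The sum telescopes, since the floor of 2 z is twice the floor of z plus its own
  parity.\<close>

lemma digit_sum:
  "(\<Sum>k<n. if digit y k then (1/2) ^ Suc k else 0) = real_of_int \<lfloor>2 ^ n * y\<rfloor> / 2 ^ n - of_int \<lfloor>y\<rfloor>"
proof (induction n)
  case (Suc n)
  have *: "\<lfloor>2 * z\<rfloor> = 2 * \<lfloor>z\<rfloor> + (if odd \<lfloor>2 * z\<rfloor> then 1 else 0)" for z :: real
  proof -
    have "2 * \<lfloor>z\<rfloor> \<le> \<lfloor>2 * z\<rfloor>" "\<lfloor>2 * z\<rfloor> \<le> 2 * \<lfloor>z\<rfloor> + 1" by linarith+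
    then show ?thesis by presburger
  qed
  have "of_int \<lfloor>2 ^ Suc n * y\<rfloor> = 2 * of_int \<lfloor>2 ^ n * y\<rfloor> + (if digit y n then 1 else 0 :: real)"
    using arg_cong[OF *[of "2 ^ n * y"], of real_of_int] by (simp add: digit_def mult.assoc split: if_splits)
  then show ?case using Suc by (simp add: field_simps)
qed simp

lemma digit_sum_approx:
  assumes "0 \<le> y" "y < 1"
  shows "\<bar>(\<Sum>k<n. if digit y k then (1/2) ^ Suc k else 0) - y\<bar> \<le> (1/2) ^ n"
proof -
  have "\<lfloor>y\<rfloor> = 0" using assms by linarith
  moreover have "\<bar>of_int \<lfloor>2 ^ n * y\<rfloor> - 2 ^ n * y\<bar> \<le> 1" by linarith
  then have "\<bar>(of_int \<lfloor>2 ^ n * y\<rfloor> - 2 ^ n * y) / 2 ^ n\<bar> \<le> 1 / 2 ^ n"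
    by (simp add: divide_right_mono)
  ultimately show ?thesis by (simp only: digit_sum) (simp add: diff_divide_distrib power_one_over)
qed

text \<open>Index (i, k) holds digit k of coordinate i. Truncation to n digits gives a continuous
  function with finite range, so integrating a function of it is a finite sum over clopen
  sets.\<close>

definition bin_partial :: "nat \<Rightarrow> ('n::finite \<times> nat \<Rightarrow> bool) \<Rightarrow> real^'n" where
  "bin_partial n u = (\<chi> i. \<Sum>k<n. if u (i, k) then (1/2) ^ Suc k else 0)"

definition bin_value :: "('n::finite \<times> nat \<Rightarrow> bool) \<Rightarrow> real^'n" where
  "bin_value u = (\<chi> i. \<Sum>k. if u (i, k) then (1/2) ^ Suc k else 0)"

definition unit_cube :: "(real^'n::finite) set" where
  "unit_cube = {y. \<forall>i. 0 \<le> y $ i \<and> y $ i \<le> 1}"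

lemma compact_unit_cube: "compact (unit_cube :: (real^'n::finite) set)"
proof -
  have "unit_cube = cbox (0 :: real^'n) (\<chi> i. 1)"
    by (auto simp: unit_cube_def mem_box_cart)
  then show ?thesis using compact_cbox by metis
qed

lemma bin_partial_LIMSEQ: "(\<lambda>n. bin_partial n u) \<longlonglongrightarrow> bin_value u"
proof (rule vec_tendstoI)
  fix i
  have "summable (\<lambda>k. if u (i, k) then (1/2) ^ Suc k else 0 :: real)"
  proof (rule summable_comparison_test')
    show "summable (\<lambda>k. (1/2) ^ Suc k :: real)" by (simp add: summable_geometric)
  qed auto
  then show "(\<lambda>n. bin_partial n u $ i) \<longlonglongrightarrow> bin_value u $ i"
    unfolding bin_partial_def bin_value_def by (simp add: summable_LIMSEQ)
qed

lemma bin_partial_unit_cube: "bin_partial n u \<in> unit_cube"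
proof -
  have "(\<Sum>k<n. if u (i, k) then (1/2) ^ Suc k else 0) \<le> (1::real)" for i
  proof -
    have "(\<Sum>k<n. if u (i, k) then (1/2) ^ Suc k else 0) \<le> (\<Sum>k<n. (1/2) ^ Suc k :: real)"
      by (intro sum_mono) auto
    also have "\<dots> = 1 - (1/2) ^ n" by (induction n) (auto simp: field_simps)
    also have "\<dots> \<le> 1" by simp
    finally show ?thesis .
  qed
  then show ?thesis by (auto simp: unit_cube_def bin_partial_def intro!: sum_nonneg)
qed

lemma bin_value_unit_cube: "bin_value u \<in> unit_cube"
  using closed_sequentially[OF compact_imp_closed[OF compact_unit_cube] bin_partial_unit_cube bin_partial_LIMSEQ] .

lemma bin_partial_continuous: "continuous_on UNIV (bin_partial n)"
proof -
  have "continuous_on UNIV (\<lambda>u :: 'n::finite \<times> nat \<Rightarrow> bool. if u p then c else 0)" for p and c :: real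
    using continuous_on_compose2[OF Topological_Spaces.continuous_on_discrete[of UNIV "\<lambda>b. if b then c else 0"]
        continuous_on_product_coordinates[of p]] by simp
  then show ?thesis unfolding bin_partial_def by (intro continuous_intros)
qed

lemma bin_partial_finite_range: "finite (range (bin_partial n :: ('n::finite \<times> nat \<Rightarrow> bool) \<Rightarrow> _))"
proof -
  define \<Phi> where "\<Phi> S = bin_partial n (\<lambda>p::'n \<times> nat. p \<in> S)" for S
  have "bin_partial n u = \<Phi> {p \<in> UNIV \<times> {..<n}. u p}" for u
    by (simp add: \<Phi>_def bin_partial_def vec_eq_iff)
  then have "range (bin_partial n) \<subseteq> \<Phi> ` Pow (UNIV \<times> {..<n})" by blast
  then show ?thesis by (rule finite_subset) auto
qed

text \<open>The \<sigma>-algebra is the one generated by the clopen sets. It contains the sets on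
  which a single digit is true, and the value is a series in the digits.\<close>

lemma bin_value_measurable:
  assumes "sets M = sigma_sets UNIV clopens"
  shows "(\<lambda>u. bin_value u $ i) \<in> borel_measurable M"
proof -
  have sp: "space M = UNIV"
    using assms sets_eq_imp_space_eq[of M "sigma UNIV clopens"] by simp
  have "{u \<in> space M. u p} \<in> sets M" for p
    using clopen_coordinate[of p] by (simp add: assms sp)
  then have [measurable]: "Measurable.pred M (\<lambda>u. u p)" for p
    by (simp add: pred_def)
  show ?thesis unfolding bin_value_def by simp
qed

subsection \<open>Representing positive functionals by measures\<close>

text \<open>A homeomorphism of R^d onto the open unit cube; the closed cube then plays the role of
  the compactification.\<close>

definition squash :: "real^'n::finite \<Rightarrow> real^'n" where
  "squash x = (\<chi> i. 1/2 + arctan (x $ i) / pi)"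

text \<open>On the faces of the cube, which correspond to points at infinity, this is a junk value
  (\<open>tan (pi / 2) = 0\<close>); they turn out to be a null set.\<close>

definition unsquash :: "real^'n::finite \<Rightarrow> real^'n" where
  "unsquash y = (\<chi> i. tan (pi * (y $ i - 1/2)))"

definition clamp_box :: "nat \<Rightarrow> real^'n::finite \<Rightarrow> real^'n" where
  "clamp_box n x = (\<chi> i. max (- real n) (min (real n) (x $ i)))"

text \<open>Clamping the angle before applying the tangent avoids the poles. The result is
  continuous on the whole closed cube and agrees inside with clamping after
  \<open>unsquash\<close>.\<close>

definition unsquash_clamp :: "nat \<Rightarrow> real^'n::finite \<Rightarrow> real^'n" where
  "unsquash_clamp n y = (\<chi> i. tan (max (- arctan (real n)) (min (arctan (real n)) (pi * (y $ i - 1/2)))))"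

lemma squash_bounds: "0 < squash x $ i" "squash x $ i < 1"
proof -
  have "- 1/2 < arctan (x $ i) / pi" "arctan (x $ i) / pi < 1/2"
    using arctan_bounded[of "x $ i"] pi_gt_zero by (auto simp: field_simps)
  then show "0 < squash x $ i" "squash x $ i < 1" unfolding squash_def vec_lambda_beta by linarith+
qed

lemma tan_clamp_arctan:
  "tan (max (- arctan r) (min (arctan r) (arctan t))) = max (- r) (min r t)"
proof -
  have "max (- arctan r) (min (arctan r) (arctan t)) = arctan (max (- r) (min r t))"
    by (auto simp: max_def min_def arctan_le_iff simp flip: arctan_minus)
  then show ?thesis by (simp add: tan_arctan)
qed

lemma unsquash_clamp_squash: "unsquash_clamp n (squash x) = clamp_box n x"
  by (simp add: unsquash_clamp_def squash_def clamp_box_def tan_clamp_arctan vec_eq_iff)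

lemma unsquash_clamp_interior:
  assumes "\<And>i. 0 < y $ i" "\<And>i. y $ i < 1"
  shows "unsquash_clamp n y = clamp_box n (unsquash y)"
proof -
  have "arctan (tan (pi * (y $ i - 1/2))) = pi * (y $ i - 1/2)" for i
  proof (rule arctan_tan)
    have "pi * (- 1/2) < pi * (y $ i - 1/2)" "pi * (y $ i - 1/2) < pi * (1/2)"
      using assms[of i] by (intro mult_strict_left_mono; simp)+
    then show "- (pi/2) < pi * (y $ i - 1/2)" "pi * (y $ i - 1/2) < pi/2" by simp_all
  qed
  then show ?thesis
    using tan_clamp_arctan[of "real n" "tan (pi * (y $ i - 1/2))" for i]
    by (simp add: unsquash_clamp_def unsquash_def clamp_box_def vec_eq_iff)
qed

text \<open>On a face the angle is pi/2 or - pi/2, so it is always clamped. The weight of the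
  clamped point is thus at least 1 + n^2 for every n, which will show that the faces are
  null.\<close>

lemma unsquash_clamp_boundary:
  assumes "y $ i = 0 \<or> y $ i = 1"
  shows "\<bar>unsquash_clamp n y $ i\<bar> = real n"
proof -
  have a: "0 \<le> arctan (real n)" "arctan (real n) < pi/2" "\<not> arctan (real n) \<le> - (pi/2)"
    using arctan_ubound[of "real n"] arctan_lbound[of "real n"] by auto
  have "unsquash_clamp n y $ i = - real n \<or> unsquash_clamp n y $ i = real n"
    using assms
  proof
    assume "y $ i = 0"
    then have "unsquash_clamp n y $ i = tan (- arctan (real n))"
      using a by (auto simp: unsquash_clamp_def min_def max_def)
    then show ?thesis by (simp add: tan_arctan)
  next
    assume "y $ i = 1"
    then have "unsquash_clamp n y $ i = tan (arctan (real n))"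
      using a by (auto simp: unsquash_clamp_def min_def max_def)
    then show ?thesis by (simp add: tan_arctan)
  qed
  then show ?thesis by auto
qed

lemma unsquash_clamp_continuous: "continuous_on UNIV (unsquash_clamp n)"
proof -
  have "cos (max (- arctan (real n)) (min (arctan (real n)) t)) \<noteq> 0" for t
  proof -
    have "- (pi/2) < max (- arctan (real n)) (min (arctan (real n)) t)"
      "max (- arctan (real n)) (min (arctan (real n)) t) < pi/2"
      using arctan_ubound[of "real n"] arctan_lbound[of "real n"] pi_gt_zero
      unfolding max_def min_def by (auto simp del: divide_minus_left)
    from cos_gt_zero_pi[OF this] show ?thesis by simp
  qed
  then show ?thesis unfolding unsquash_clamp_def
    by (intro continuous_on_vec_lambda
        continuous_on_compose2[OF isCont_tan[THEN continuous_at_imp_continuous_on[OF ballI]], of "{t. cos t \<noteq> 0}"]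
        continuous_intros) auto
qed

lemma clamp_box_abs_le: "\<bar>clamp_box n x $ i\<bar> \<le> \<bar>x $ i\<bar>"
  by (auto simp: clamp_box_def)

lemma weight_clamp_box: "weight (clamp_box n x) \<le> weight x"
  by (intro weight_mono clamp_box_abs_le)

lemma clamp_box_eventually: "eventually (\<lambda>n. clamp_box n x = x) sequentially"
proof -
  obtain N where N: "norm x \<le> real N" using real_arch_simple by blast
  have "clamp_box n x = x" if "n \<ge> N" for n
  proof -
    have "x $ i \<le> real n \<and> - real n \<le> x $ i" for i
      using component_le_norm_cart[of x i] N that by linarith
    then show ?thesis by (simp add: clamp_box_def vec_eq_iff min_absorb2 max_absorb2)
  qed
  then show ?thesis unfolding eventually_sequentially by blast
qed

text \<open>Clamping moves x only if some coordinate has absolute value at least n. This drives a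
  Chebyshev-type estimate of the clamping error.\<close>

lemma clamp_box_neq: "clamp_box n x \<noteq> x \<Longrightarrow> 1 + (real n)\<^sup>2 \<le> weight x"
proof -
  assume "clamp_box n x \<noteq> x"
  then obtain i where "clamp_box n x $ i \<noteq> x $ i" by (auto simp: vec_eq_iff)
  then have "real n \<le> \<bar>x $ i\<bar>" by (auto simp: clamp_box_def min_def max_def split: if_splits)
  then have "(real n)\<^sup>2 \<le> (x $ i)\<^sup>2" using abs_le_square_iff[of "real n" "x $ i"] by simp
  with coord_le_weight[of x i] show ?thesis by linarith
qed

lemma poly_growth_const: "(\<lambda>x. c) \<in> poly_growth"
  by (intro poly_funs_subset_growth poly_funs_const)

lemma fun_subspace_poly_growth: "fun_subspace (poly_growth :: (real^'n::finite \<Rightarrow> real) set)"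
  unfolding fun_subspace_def
proof (intro conjI ballI allI)
  show "(\<lambda>_. 0) \<in> (poly_growth :: (real^'n \<Rightarrow> real) set)" by (rule poly_growth_const)
next
  fix f g :: "real^'n \<Rightarrow> real" assume "f \<in> poly_growth" "g \<in> poly_growth"
  then obtain p q where "p \<in> poly_funs" "q \<in> poly_funs" "\<And>x. \<bar>f x\<bar> \<le> p x" "\<And>x. \<bar>g x\<bar> \<le> q x"
    by (auto simp: poly_growth_def)
  then show "(\<lambda>x. f x + g x) \<in> poly_growth"
    unfolding poly_growth_def
    by (auto intro!: bexI[of _ "\<lambda>x. p x + q x"] poly_funs_add intro: order_trans[OF abs_triangle_ineq add_mono])
next
  fix f :: "real^'n \<Rightarrow> real" and c assume "f \<in> poly_growth"
  then obtain p where "p \<in> poly_funs" "\<And>x. \<bar>f x\<bar> \<le> p x" by (auto simp: poly_growth_def)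
  then show "(\<lambda>x. c * f x) \<in> poly_growth"
    unfolding poly_growth_def
    by (auto intro!: bexI[of _ "\<lambda>x. \<bar>c\<bar> * p x"] poly_funs_cmult mult_left_mono simp: abs_mult)
qed

section \<open>Positive functionals on functions of polynomial growth\<close>

locale positive_functional =
  fixes \<Lambda> :: "(real^'n::finite \<Rightarrow> real) \<Rightarrow> real"
  assumes linear: "linear_on_funs poly_growth \<Lambda>"
    and nonneg: "f \<in> poly_growth \<Longrightarrow> (\<And>x. 0 \<le> f x) \<Longrightarrow> 0 \<le> \<Lambda> f"
begin

lemmas add = linear_on_funs_add[OF linear]
lemmas cmult = linear_on_funs_cmult[OF linear]
lemmas growth_add = fun_subspace_add[OF fun_subspace_poly_growth]
lemmas growth_cmult = fun_subspace_cmult[OF fun_subspace_poly_growth]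

lemma mono:
  assumes "f \<in> poly_growth" "g \<in> poly_growth" "\<And>x. f x \<le> g x"
  shows "\<Lambda> f \<le> \<Lambda> g"
proof -
  have mf: "(\<lambda>x. (-1) * f x) \<in> poly_growth" by (intro growth_cmult assms)
  have "0 \<le> \<Lambda> (\<lambda>x. g x + (-1) * f x)"
    by (intro nonneg growth_add assms mf) (simp add: assms)
  also have "\<dots> = \<Lambda> g + (-1) * \<Lambda> f"
    using add[OF assms(2) mf] cmult[OF assms(1), of "-1"] by simp
  finally show ?thesis by simp
qed

lemma abs_diff_le:
  assumes "f \<in> poly_growth" "g \<in> poly_growth" "h \<in> poly_growth" "\<And>x. \<bar>f x - g x\<bar> \<le> h x"
  shows "\<bar>\<Lambda> f - \<Lambda> g\<bar> \<le> \<Lambda> h"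
proof -
  have "\<Lambda> f \<le> \<Lambda> (\<lambda>x. g x + h x)" "\<Lambda> g \<le> \<Lambda> (\<lambda>x. f x + h x)"
    using assms(4) by (auto intro!: mono growth_add assms simp: abs_le_iff algebra_simps)
  then show ?thesis using assms by (simp add: add abs_le_iff)
qed

lemma zero: "\<Lambda> (\<lambda>x. 0) = 0"
  using cmult[OF poly_growth_const[of 0], of 0] by simp

lemma sum:
  assumes "finite I" "\<And>i. i \<in> I \<Longrightarrow> f i \<in> poly_growth"
  shows "(\<lambda>x. \<Sum>i\<in>I. f i x) \<in> poly_growth \<and> \<Lambda> (\<lambda>x. \<Sum>i\<in>I. f i x) = (\<Sum>i\<in>I. \<Lambda> (f i))"
  using assms
proof (induction I)
  case empty
  then show ?case using zero poly_growth_const by simp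
next
  case (insert i I)
  then have IH: "(\<lambda>x. \<Sum>i\<in>I. f i x) \<in> poly_growth" "\<Lambda> (\<lambda>x. \<Sum>i\<in>I. f i x) = (\<Sum>i\<in>I. \<Lambda> (f i))"
    and fi: "f i \<in> poly_growth" by auto
  show ?case
    using insert.hyps growth_add[OF fi IH(1)] add[OF fi IH(1)] IH(2) by simp
qed

text \<open>This map is discontinuous, but any indicator composed with it is bounded and so lies in
  the domain of \<Lambda>.\<close>

definition code :: "real^'n \<Rightarrow> 'n \<times> nat \<Rightarrow> bool" where
  "code x = (\<lambda>(i, k). digit (squash x $ i) k)"

lemma bin_partial_code: "\<bar>(bin_partial n (code x) - squash x) $ i\<bar> \<le> (1/2) ^ n"
  using digit_sum_approx[of "squash x $ i" n] squash_bounds[of x i]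
  by (simp add: bin_partial_def code_def)

lemma indicator_growth: "(\<lambda>x. indicator A (f x)) \<in> poly_growth"
  by (rule bounded_poly_growth[of _ 1]) (simp add: indicator_def)

lemma continuous_unit_cube_bound:
  fixes G :: "real^'n \<Rightarrow> real"
  assumes "continuous_on UNIV G"
  obtains B where "\<And>y. y \<in> unit_cube \<Longrightarrow> \<bar>G y\<bar> \<le> B"
proof -
  have "bounded (G ` unit_cube)"
    by (intro compact_imp_bounded compact_continuous_image compact_unit_cube
        continuous_on_subset[OF assms]) auto
  then show ?thesis using that by (auto simp: bounded_iff)
qed

lemma squash_unit_cube: "squash x \<in> unit_cube"
  using squash_bounds[of x] by (auto simp: unit_cube_def intro: less_imp_le)

text \<open>The set function is \<Lambda> applied to indicators composed with \<open>code\<close>.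
  For functions of the first n digits both sides are the same finite sum; uniform continuity of G on
  the cube then permits n to tend to infinity.\<close>

theorem Cantor_representation:
  obtains M where "sets M = sigma_sets UNIV clopens" "finite_measure M"
    "\<And>G. continuous_on UNIV G \<Longrightarrow> (LINT u|M. G (bin_value u)) = \<Lambda> (\<lambda>x. G (squash x))"
proof -
  define m where "m A = \<Lambda> (\<lambda>x. indicator A (code x))" for A
  have m_add: "m (A \<union> B) = m A + m B" if "A \<inter> B = {}" for A B
  proof -
    have "(\<lambda>x. indicator (A \<union> B) (code x) :: real) = (\<lambda>x. indicator A (code x) + indicator B (code x))"
      using that by (intro ext) (auto simp: indicator_def)
    then show ?thesis unfolding m_def by (simp add: add indicator_growth)
  qed
  have m_pos: "0 \<le> m A" for A
    unfolding m_def by (intro nonneg indicator_growth) simp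
  obtain M where M: "sets M = sigma_sets UNIV clopens" "finite_measure M"
    "\<And>A. A \<in> clopens \<Longrightarrow> measure M A = m A"
    using Cantor_measure[of m] m_pos m_add by blast
  interpret finite_measure M by fact
  have sp: "space M = UNIV"
    using M(1) sets_eq_imp_space_eq[of M "sigma UNIV clopens"] by simp
  have simple: "(\<lambda>x. G (bin_partial n (code x))) \<in> poly_growth \<and>
      (\<lambda>u. G (bin_partial n u)) \<in> borel_measurable M \<and>
      (LINT u|M. G (bin_partial n u)) = \<Lambda> (\<lambda>x. G (bin_partial n (code x)))" for G :: "real^'n \<Rightarrow> real" and n
  proof -
    define R where "R = range (bin_partial n :: ('n \<times> nat \<Rightarrow> bool) \<Rightarrow> _)"
    define L where "L v = bin_partial n -` {v}" for v :: "real^'n"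
    have fin: "finite R" unfolding R_def by (rule bin_partial_finite_range)
    have L: "L v \<in> clopens" for v
      unfolding L_def by (rule clopen_level_set[OF bin_partial_continuous bin_partial_finite_range])
    then have [measurable]: "L v \<in> sets M" for v by (simp add: M(1))
    have eq: "G (bin_partial n u) = (\<Sum>v\<in>R. G v * indicator (L v) u)" for u
    proof -
      have "(\<Sum>v\<in>R. G v * indicator (L v) u) = (\<Sum>v\<in>R. if v = bin_partial n u then G v else 0)"
        by (intro sum.cong refl) (auto simp: L_def)
      then show ?thesis using fin by (simp add: R_def)
    qed
    have s: "(\<lambda>x. \<Sum>v\<in>R. G v * indicator (L v) (code x)) \<in> poly_growth \<and>
      \<Lambda> (\<lambda>x. \<Sum>v\<in>R. G v * indicator (L v) (code x)) = (\<Sum>v\<in>R. \<Lambda> (\<lambda>x. G v * indicator (L v) (code x)))"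
      by (rule sum[OF fin]) (intro growth_cmult indicator_growth)
    have "(LINT u|M. (\<Sum>v\<in>R. G v * indicator (L v) u)) = (\<Sum>v\<in>R. G v * m (L v))"
      using L M(3) by (subst Bochner_Integration.integral_sum) (auto simp: less_top[symmetric])
    also have "\<dots> = (\<Sum>v\<in>R. \<Lambda> (\<lambda>x. G v * indicator (L v) (code x)))"
      by (simp add: m_def cmult indicator_growth)
    finally show ?thesis unfolding eq using s by simp
  qed
  have "(LINT u|M. G (bin_value u)) = \<Lambda> (\<lambda>x. G (squash x))" if G: "continuous_on UNIV G" for G
  proof -
    obtain B where B: "\<And>y. y \<in> unit_cube \<Longrightarrow> \<bar>G y\<bar> \<le> B"
      using continuous_unit_cube_bound[OF G] by blast
    have g1: "(\<lambda>x. G (squash x)) \<in> poly_growth"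
      by (rule bounded_poly_growth[of _ B]) (intro B squash_unit_cube)
    note one = poly_growth_const
    have lim: "(\<lambda>n. G (bin_partial n u)) \<longlonglongrightarrow> G (bin_value u)" for u
      using G by (intro isCont_tendsto_compose[OF _ bin_partial_LIMSEQ]) (simp add: continuous_on_eq_continuous_at)
    have "(\<lambda>n. LINT u|M. G (bin_partial n u)) \<longlonglongrightarrow> (LINT u|M. G (bin_value u))"
    proof (rule integral_dominated_convergence[where w="\<lambda>_. B"])
      show "(\<lambda>u. G (bin_partial n u)) \<in> borel_measurable M" for n using simple by blast
      show "(\<lambda>u. G (bin_value u)) \<in> borel_measurable M"
        by (rule borel_measurable_LIMSEQ_real[OF lim]) (use simple in blast)+
    qed (use lim B[OF bin_partial_unit_cube] in auto)
    moreover have "(\<lambda>n. LINT u|M. G (bin_partial n u)) \<longlonglongrightarrow> \<Lambda> (\<lambda>x. G (squash x))"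
    proof (rule LIMSEQ_I)
      fix r :: real assume r: "r > 0"
      have L1: "0 \<le> \<Lambda> (\<lambda>x. 1)" by (intro nonneg one) simp
      \<comment> \<open>The summand 1 covers the case that \<Lambda> vanishes on constants.\<close>
      define e where "e = r / (\<Lambda> (\<lambda>x. 1) + 1)"
      have e: "e > 0" "e * \<Lambda> (\<lambda>x. 1) < r" using r L1 by (auto simp: e_def field_simps)
      have "uniformly_continuous_on unit_cube G"
        by (intro compact_uniformly_continuous compact_unit_cube continuous_on_subset[OF G]) auto
      then obtain d where d: "d > 0" "\<And>y z. y \<in> unit_cube \<Longrightarrow> z \<in> unit_cube \<Longrightarrow> dist z y < d \<Longrightarrow> dist (G z) (G y) < e"
        using e(1) unfolding uniformly_continuous_on_def by metis
      \<comment> \<open>Each coordinate of the truncation is off by at most (1/2)^n, so the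
        Euclidean norm of the error is at most \<open>CARD('n)\<close> times that, by comparison
        with the l1 norm.\<close>
      have "(\<lambda>n. real CARD('n) * (1/2) ^ n) \<longlonglongrightarrow> real CARD('n) * 0"
        by (intro tendsto_intros LIMSEQ_power_zero) simp
      then have "eventually (\<lambda>n. real CARD('n) * (1/2) ^ n < d) sequentially"
        using d(1) by (intro order_tendstoD) auto
      then obtain N where N: "\<And>n. n \<ge> N \<Longrightarrow> real CARD('n) * (1/2) ^ n < d"
        unfolding eventually_sequentially by blast
      have "norm ((LINT u|M. G (bin_partial n u)) - \<Lambda> (\<lambda>x. G (squash x))) < r" if n: "n \<ge> N" for n
      proof -
        have "\<bar>G (bin_partial n (code x)) - G (squash x)\<bar> \<le> e" for x
        proof -
          have "norm (bin_partial n (code x) - squash x) \<le> (\<Sum>i\<in>UNIV. \<bar>(bin_partial n (code x) - squash x) $ i\<bar>)"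
            by (rule norm_le_l1_cart)
          also have "\<dots> \<le> (\<Sum>i\<in>(UNIV::'n set). (1/2) ^ n)"
            by (intro sum_mono bin_partial_code)
          also have "\<dots> < d" using N[OF n] by simp
          finally show ?thesis
            using d(2)[OF squash_unit_cube[of x] bin_partial_unit_cube[of n "code x"]]
            by (simp add: dist_norm)
        qed
        then have "\<bar>\<Lambda> (\<lambda>x. G (bin_partial n (code x))) - \<Lambda> (\<lambda>x. G (squash x))\<bar> \<le> \<Lambda> (\<lambda>x. e * 1)"
          using simple g1 one by (intro abs_diff_le) auto
        also have "\<dots> = e * \<Lambda> (\<lambda>x. 1)" by (rule cmult[OF one])
        finally show ?thesis using simple e(2) by simp
      qed
      then show "\<exists>no. \<forall>n\<ge>no. norm ((LINT u|M. G (bin_partial n u)) - \<Lambda> (\<lambda>x. G (squash x))) < r" by blast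
    qed
    ultimately show ?thesis by (rule LIMSEQ_unique)
  qed
  then show ?thesis using that M by blast
qed

text \<open>\<Lambda> comes with no convergence theorem, so an explicit estimate is made: the error
  lives where the weight is at least 1 + n^2, and there one extra power of the weight pays for a
  factor 1 / (1 + n^2).\<close>

lemma clamp_box_LIMSEQ:
  assumes f: "f \<in> poly_growth"
  shows "(\<lambda>n. \<Lambda> (\<lambda>x. f (clamp_box n x))) \<longlonglongrightarrow> \<Lambda> f"
proof -
  obtain C k where C: "C \<ge> 0" "\<And>x. \<bar>f x\<bar> \<le> C * weight x ^ k"
    using poly_growth_le_weight[OF f] by blast
  have W: "(\<lambda>x. weight x ^ Suc k) \<in> poly_growth"
    by (intro poly_funs_subset_growth weight_power_poly)
  have fc: "\<bar>f (clamp_box n x)\<bar> \<le> C * weight x ^ k" for n x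
  proof -
    have "weight (clamp_box n x) ^ k \<le> weight x ^ k"
      using weight_clamp_box[of n x] weight_ge_1[of "clamp_box n x"] by (intro power_mono) auto
    then show ?thesis using C(2)[of "clamp_box n x"] mult_left_mono[OF _ C(1)] by (meson order_trans)
  qed
  have bound: "\<bar>\<Lambda> (\<lambda>x. f (clamp_box n x)) - \<Lambda> f\<bar> \<le> (2 * C / (1 + (real n)\<^sup>2)) * \<Lambda> (\<lambda>x. weight x ^ Suc k)" for n
  proof -
    have "\<bar>\<Lambda> (\<lambda>x. f (clamp_box n x)) - \<Lambda> f\<bar> \<le> \<Lambda> (\<lambda>x. (2 * C / (1 + (real n)\<^sup>2)) * weight x ^ Suc k)"
    proof (rule abs_diff_le[OF _ f growth_cmult[OF W]])
      show "(\<lambda>x. f (clamp_box n x)) \<in> poly_growth" using fc by (rule poly_growthI)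
      fix x
      have n1: "1 + (real n)\<^sup>2 > 0" by (simp add: add_pos_nonneg)
      show "\<bar>f (clamp_box n x) - f x\<bar> \<le> 2 * C / (1 + (real n)\<^sup>2) * weight x ^ Suc k"
      proof (cases "clamp_box n x = x")
        case True
        then show ?thesis using C(1) weight_ge_1[of x] n1 by simp
      next
        case False
        have "\<bar>f (clamp_box n x) - f x\<bar> \<le> 2 * C * weight x ^ k"
          using fc[of n x] C(2)[of x] by linarith
        also have "\<dots> \<le> (2 * C * weight x ^ k) * (weight x / (1 + (real n)\<^sup>2))"
        proof -
          have "1 \<le> weight x / (1 + (real n)\<^sup>2)"
            using clamp_box_neq[OF False] n1 by (simp add: field_simps)
          moreover have "0 \<le> 2 * C * weight x ^ k" using C(1) weight_ge_1[of x] by simp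
          ultimately show ?thesis by (metis mult.right_neutral mult_left_mono)
        qed
        finally show ?thesis by (simp add: field_simps)
      qed
    qed
    then show ?thesis by (simp only: cmult[OF W])
  qed
  have "(\<lambda>n. (2 * C / (1 + (real n)\<^sup>2)) * \<Lambda> (\<lambda>x. weight x ^ Suc k)) \<longlonglongrightarrow> 0"
  proof -
    have "(\<lambda>n. (2 * C / (1 + (real n)\<^sup>2))) \<longlonglongrightarrow> 0" by real_asymp
    then show ?thesis by (rule tendsto_mult_left_zero)
  qed
  then have "(\<lambda>n. \<Lambda> (\<lambda>x. f (clamp_box n x)) - \<Lambda> f) \<longlonglongrightarrow> 0"
    by (rule Lim_null_comparison[rotated]) (use bound in simp)
  then show ?thesis by (simp add: LIM_zero_iff)
qed

text \<open>The measure is the image under \<open>unsquash\<close> of the decoded Cantor measure.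
  Clamped functions are continuous on the closed cube, so their integrals are known; bounds on all
  powers of the weight remove the faces and provide dominating functions for removing the
  clamp.\<close>

theorem measure_representation:
  obtains \<nu> where "sets \<nu> = sets borel"
    "\<And>f. f \<in> poly_growth \<Longrightarrow> continuous_on UNIV f \<Longrightarrow> integrable \<nu> f \<and> integral\<^sup>L \<nu> f = \<Lambda> f"
proof -
  obtain M where M: "sets M = sigma_sets UNIV clopens" "finite_measure M"
    and rep: "\<And>G. continuous_on UNIV G \<Longrightarrow> (LINT u|M. G (bin_value u)) = \<Lambda> (\<lambda>x. G (squash x))"
    using Cantor_representation by blast
  interpret finite_measure M by fact
  have vecm: "g \<in> borel_measurable M" if "\<And>i. (\<lambda>u. g u $ i) \<in> borel_measurable M" for g :: "_ \<Rightarrow> real^'n"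
    using that by (subst borel_measurable_euclidean_space) (auto simp: Basis_vec_def inner_axis)
  note [measurable] = bin_value_measurable[OF M(1)] vecm[OF bin_value_measurable[OF M(1)]]
  define X :: "('n \<times> nat \<Rightarrow> bool) \<Rightarrow> real^'n" where "X u = unsquash (bin_value u)" for u
  have [measurable]: "X \<in> borel_measurable M"
    unfolding X_def unsquash_def tan_def by (rule vecm) simp
  define T :: "nat \<Rightarrow> ('n \<times> nat \<Rightarrow> bool) \<Rightarrow> real^'n"
    where "T n u = unsquash_clamp n (bin_value u)" for n u
  have [measurable]: "T n \<in> borel_measurable M" for n
    unfolding T_def using borel_measurable_continuous_onI[OF unsquash_clamp_continuous] by measurable
  have T_int: "integrable M (\<lambda>u. f (T n u))" "(LINT u|M. f (T n u)) = \<Lambda> (\<lambda>x. f (clamp_box n x))"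
    if f: "continuous_on UNIV f" for f n
  proof -
    have c: "continuous_on UNIV (\<lambda>y. f (unsquash_clamp n y))"
      by (rule continuous_on_compose2[OF f unsquash_clamp_continuous]) auto
    show "(LINT u|M. f (T n u)) = \<Lambda> (\<lambda>x. f (clamp_box n x))"
      using rep[OF c] by (simp add: T_def unsquash_clamp_squash)
    obtain B where "\<And>y. y \<in> unit_cube \<Longrightarrow> \<bar>f (unsquash_clamp n y)\<bar> \<le> B"
      using continuous_unit_cube_bound[OF c] by blast
    then have "\<bar>f (T n u)\<bar> \<le> B" for u
      by (simp add: T_def bin_value_unit_cube)
    then show "integrable M (\<lambda>u. f (T n u))"
      using borel_measurable_continuous_onI[OF f] by (intro integrable_const_bound[of _ B]) auto
  qed
  have cw: "continuous_on UNIV (\<lambda>x::real^'n. weight x ^ k)" for k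
    by (intro poly_funs_continuous weight_power_poly)
  have [measurable]: "(weight :: real^'n \<Rightarrow> real) \<in> borel_measurable borel"
    using borel_measurable_continuous_onI[OF cw[of 1]] by simp
  \<comment> \<open>Stated with a limes inferior because the limit of \<open>T n u\<close> is not
    known before the faces are shown to be null, which the case k = 1 achieves: there the limes
    inferior is infinite.\<close>
  have Fatou: "(\<integral>\<^sup>+u. liminf (\<lambda>n. ennreal (weight (T n u) ^ k)) \<partial>M) < \<infinity>" for k
  proof -
    have W: "(\<lambda>x. weight x ^ k) \<in> poly_growth"
      by (intro poly_funs_subset_growth weight_power_poly)
    have le: "weight (clamp_box n x) ^ k \<le> weight x ^ k" for n and x :: "real^'n"
      using weight_clamp_box[of n x] weight_ge_1[of "clamp_box n x"] by (intro power_mono) auto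
    have "(\<integral>\<^sup>+u. ennreal (weight (T n u) ^ k) \<partial>M) \<le> ennreal (\<Lambda> (\<lambda>x. weight x ^ k))" for n
    proof -
      have "(\<integral>\<^sup>+u. ennreal (weight (T n u) ^ k) \<partial>M) = ennreal (\<Lambda> (\<lambda>x. weight (clamp_box n x) ^ k))"
        using T_int[OF cw] by (subst nn_integral_eq_integral) auto
      also have "\<dots> \<le> ennreal (\<Lambda> (\<lambda>x. weight x ^ k))"
      proof (intro ennreal_leI mono W le)
        show "(\<lambda>x::real^'n. weight (clamp_box n x) ^ k) \<in> poly_growth"
          using le[of n] by (intro poly_growthI[where C=1 and k=k]) simp
      qed
      finally show ?thesis .
    qed
    then have "liminf (\<lambda>n. \<integral>\<^sup>+u. ennreal (weight (T n u) ^ k) \<partial>M) \<le> ennreal (\<Lambda> (\<lambda>x. weight x ^ k))"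
      by (intro order_trans[OF Liminf_mono Liminf_const[THEN eq_refl]]) (auto intro!: always_eventually)
    moreover have "(\<integral>\<^sup>+u. liminf (\<lambda>n. ennreal (weight (T n u) ^ k)) \<partial>M)
        \<le> liminf (\<lambda>n. \<integral>\<^sup>+u. ennreal (weight (T n u) ^ k) \<partial>M)"
      by (rule nn_integral_liminf) measurable
    ultimately have "(\<integral>\<^sup>+u. liminf (\<lambda>n. ennreal (weight (T n u) ^ k)) \<partial>M) \<le> ennreal (\<Lambda> (\<lambda>x. weight x ^ k))"
      by (rule order_trans[rotated])
    then show ?thesis by (rule le_less_trans) simp
  qed
  have "AE u in M. liminf (\<lambda>n. ennreal (weight (T n u) ^ 1)) \<noteq> \<infinity>"
    using Fatou[of 1] by (intro nn_integral_noteq_infinite) auto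
  then have interior: "AE u in M. \<forall>i. 0 < bin_value u $ i \<and> bin_value u $ i < 1"
  proof eventually_elim
    case (elim u)
    show ?case
    proof (rule ccontr)
      assume "\<not> (\<forall>i. 0 < bin_value u $ i \<and> bin_value u $ i < 1)"
      then obtain i where "\<not> (0 < bin_value u $ i \<and> bin_value u $ i < 1)" by blast
      moreover have "0 \<le> bin_value u $ i" "bin_value u $ i \<le> 1"
        using bin_value_unit_cube[of u] by (auto simp: unit_cube_def)
      ultimately have i: "bin_value u $ i = 0 \<or> bin_value u $ i = 1" by linarith
      have "real n \<le> weight (T n u)" for n
      proof -
        have "1 + (real n)\<^sup>2 \<le> weight (T n u)"
          using coord_le_weight[of "T n u" i] unsquash_clamp_boundary[OF i, of n]
          by (metis T_def power2_abs)
        moreover have "real n \<le> (real n)\<^sup>2" by (cases n) (auto simp: power2_eq_square)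
        ultimately show ?thesis by linarith
      qed
      then have "(\<lambda>n. ennreal (weight (T n u) ^ 1)) \<longlonglongrightarrow> \<infinity>"
        unfolding infinity_ennreal_def ennreal_tendsto_top_eq_at_top
        by (intro filterlim_at_top_mono[OF filterlim_real_sequentially]) simp
      then have "liminf (\<lambda>n. ennreal (weight (T n u) ^ 1)) = \<infinity>"
        by (intro lim_imp_Liminf) auto
      with elim show False by simp
    qed
  qed
  then have TX: "AE u in M. \<forall>n. T n u = clamp_box n (X u)"
    by eventually_elim (simp add: T_def X_def unsquash_clamp_interior)
  then have Tev: "AE u in M. eventually (\<lambda>n. T n u = X u) sequentially"
    by eventually_elim (use clamp_box_eventually in \<open>auto elim: eventually_mono\<close>)
  \<comment> \<open>Off the null set of faces the sequence is eventually constant, so the integrand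
    is the limes inferior bounded above. All powers are needed to dominate functions of arbitrary
    polynomial growth.\<close>
  have intW: "integrable M (\<lambda>u. weight (X u) ^ k)" for k
  proof (rule integrableI_bounded)
    have "(\<integral>\<^sup>+u. ennreal (norm (weight (X u) ^ k)) \<partial>M) = (\<integral>\<^sup>+u. liminf (\<lambda>n. ennreal (weight (T n u) ^ k)) \<partial>M)"
    proof (rule nn_integral_cong_AE)
      show "AE u in M. ennreal (norm (weight (X u) ^ k)) = liminf (\<lambda>n. ennreal (weight (T n u) ^ k))"
        using Tev
      proof eventually_elim
        case (elim u)
        then have "(\<lambda>n. ennreal (weight (T n u) ^ k)) \<longlonglongrightarrow> ennreal (weight (X u) ^ k)"
          by (intro tendsto_eventually) (auto elim: eventually_mono)
        then have "liminf (\<lambda>n. ennreal (weight (T n u) ^ k)) = ennreal (weight (X u) ^ k)"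
          by (intro lim_imp_Liminf) auto
        then show ?case using weight_ge_1[of "X u"] by simp
      qed
    qed
    then show "(\<integral>\<^sup>+u. ennreal (norm (weight (X u) ^ k)) \<partial>M) < \<infinity>" using Fatou by simp
  qed measurable
  define \<nu> where "\<nu> = distr M borel X"
  have "integrable \<nu> f \<and> integral\<^sup>L \<nu> f = \<Lambda> f" if f: "f \<in> poly_growth" "continuous_on UNIV f" for f
  proof -
    have [measurable]: "f \<in> borel_measurable borel" using borel_measurable_continuous_onI[OF f(2)] .
    obtain C k where C: "C \<ge> 0" "\<And>x. \<bar>f x\<bar> \<le> C * weight x ^ k"
      using poly_growth_le_weight[OF f(1)] by blast
    have dom: "AE u in M. norm (f (T n u)) \<le> C * weight (X u) ^ k" for n
      using TX
    proof eventually_elim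
      case (elim u)
      have "weight (T n u) ^ k \<le> weight (X u) ^ k"
        using weight_clamp_box[of n "X u"] weight_ge_1[of "T n u"] elim by (intro power_mono) auto
      then show ?case using C(2)[of "T n u"] mult_left_mono[OF _ C(1)] by (fastforce intro: order_trans)
    qed
    have lim: "AE u in M. (\<lambda>n. f (T n u)) \<longlonglongrightarrow> f (X u)"
      using Tev by eventually_elim (auto intro!: tendsto_eventually elim: eventually_mono)
    have meas: "(\<lambda>u. f (X u)) \<in> borel_measurable M" "\<And>n. (\<lambda>u. f (T n u)) \<in> borel_measurable M"
      by measurable
    have "integrable M (\<lambda>u. f (X u))"
      by (rule integrable_dominated_convergence[OF meas _ lim dom]) (intro integrable_mult_right intW)
    moreover have "(\<lambda>n. LINT u|M. f (T n u)) \<longlonglongrightarrow> (LINT u|M. f (X u))"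
      by (rule integral_dominated_convergence[OF meas _ lim dom]) (intro integrable_mult_right intW)
    then have "(LINT u|M. f (X u)) = \<Lambda> f"
      \<comment> \<open>The same sequence has two limits: one by dominated convergence for M, one by
        the clamping estimate for \<Lambda>.\<close>
      using clamp_box_LIMSEQ[OF f(1)] unfolding T_int(2)[OF f(2)] by (rule LIMSEQ_unique)
    ultimately show ?thesis
      unfolding \<nu>_def by (simp add: integrable_distr_eq integral_distr)
  qed
  then show ?thesis using that[of \<nu>] by (simp add: \<nu>_def)
qed

end

subsection \<open>The moment problem\<close>

text \<open>Extends \<open>upper_val\<close> from cosines to arbitrary functions, to serve as the
  sublinear bound in Hahn--Banach.\<close>

definition majorant_val :: "(real^'n::finite) measure \<Rightarrow> (real^'n \<Rightarrow> real) \<Rightarrow> real" where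
  "majorant_val \<mu> f = Inf {integral\<^sup>L \<mu> q | q. q \<in> poly_funs \<and> (\<forall>x. f x \<le> q x)}"

lemma admissible_integrable: "admissible \<mu> \<Longrightarrow> p \<in> poly_funs \<Longrightarrow> integrable \<mu> p"
  by (simp add: admissible_def)

lemma admissible_sets: "admissible \<mu> \<Longrightarrow> sets \<mu> = sets borel"
  by (simp add: admissible_def)

lemma admissible_finite_measure:
  assumes "admissible (\<mu> :: (real^'n::finite) measure)"
  shows "finite_measure \<mu>"
proof -
  have "integrable \<mu> (\<lambda>x. 1 :: real)"
    using admissible_integrable[OF assms poly_funs_const] .
  then show ?thesis by (intro finite_measureI) (simp add: integrable_iff_bounded less_top[symmetric])
qed

lemma poly_integral_mono:
  assumes "admissible \<mu>" "p \<in> poly_funs" "q \<in> poly_funs" "\<And>x. p x \<le> q x"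
  shows "integral\<^sup>L \<mu> p \<le> integral\<^sup>L \<mu> q"
  using assms by (intro integral_mono admissible_integrable) auto

lemma majorant_bdd_below:
  assumes \<mu>: "admissible \<mu>" and f: "f \<in> poly_growth"
  shows "bdd_below {integral\<^sup>L \<mu> q | q. q \<in> poly_funs \<and> (\<forall>x. f x \<le> q x)}"
proof -
  obtain p where p: "p \<in> poly_funs" "\<And>x. \<bar>f x\<bar> \<le> p x"
    using f by (auto simp: poly_growth_def)
  have "integral\<^sup>L \<mu> (\<lambda>x. - p x) \<le> integral\<^sup>L \<mu> q" if q: "q \<in> poly_funs" "\<And>x. f x \<le> q x" for q
  proof (rule poly_integral_mono[OF \<mu> poly_funs_uminus[OF p(1)] q(1)])
    show "- p x \<le> q x" for x using p(2)[of x] q(2)[of x] by linarith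
  qed
  then show ?thesis by (intro bdd_belowI) blast
qed

lemma majorant_val_le:
  assumes "admissible \<mu>" "f \<in> poly_growth" "q \<in> poly_funs" "\<And>x. f x \<le> q x"
  shows "majorant_val \<mu> f \<le> integral\<^sup>L \<mu> q"
  unfolding majorant_val_def using assms by (intro cInf_lower majorant_bdd_below) auto

text \<open>Polynomial growth supplies at least one majorant, so the infimum is not over the empty
  set.\<close>

lemma majorant_val_greatest:
  assumes f: "f \<in> poly_growth"
    and le: "\<And>q. q \<in> poly_funs \<Longrightarrow> (\<And>x. f x \<le> q x) \<Longrightarrow> c \<le> integral\<^sup>L \<mu> q"
  shows "c \<le> majorant_val \<mu> f"
proof -
  obtain p where "p \<in> poly_funs" "\<And>x. \<bar>f x\<bar> \<le> p x"
    using f by (auto simp: poly_growth_def)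
  then have "p \<in> poly_funs \<and> (\<forall>x. f x \<le> p x)" by (auto simp: abs_le_iff)
  then show ?thesis
    unfolding majorant_val_def using le by (intro cInf_greatest) auto
qed

lemma majorant_val_sublinear:
  fixes \<mu> :: "(real^'n::finite) measure"
  assumes \<mu>: "admissible \<mu>"
  shows "sublinear_on poly_growth (majorant_val \<mu>)"
proof (rule sublinear_onI[OF fun_subspace_poly_growth])
  show "majorant_val \<mu> (\<lambda>x. 0) \<le> 0"
    using majorant_val_le[OF \<mu> poly_growth_const poly_funs_const, of 0 0] by simp
next
  fix f g :: "real^'n \<Rightarrow> real" assume f: "f \<in> poly_growth" and g: "g \<in> poly_growth"
  have *: "majorant_val \<mu> (\<lambda>x. f x + g x) \<le> integral\<^sup>L \<mu> p + integral\<^sup>L \<mu> q"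
    if p: "p \<in> poly_funs" "\<And>x. f x \<le> p x" and q: "q \<in> poly_funs" "\<And>x. g x \<le> q x" for p q
  proof -
    have "majorant_val \<mu> (\<lambda>x. f x + g x) \<le> integral\<^sup>L \<mu> (\<lambda>x. p x + q x)"
      by (intro majorant_val_le[OF \<mu>] fun_subspace_add[OF fun_subspace_poly_growth] f g
          poly_funs_add p q add_mono)
    also have "\<dots> = integral\<^sup>L \<mu> p + integral\<^sup>L \<mu> q"
      using p q by (intro Bochner_Integration.integral_add admissible_integrable[OF \<mu>])
    finally show ?thesis .
  qed
  have "majorant_val \<mu> (\<lambda>x. f x + g x) - integral\<^sup>L \<mu> q \<le> majorant_val \<mu> f"
    if q: "q \<in> poly_funs" "\<And>x. g x \<le> q x" for q
    using *[OF _ _ q] by (intro majorant_val_greatest[OF f]) (simp add: algebra_simps)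
  then have "majorant_val \<mu> (\<lambda>x. f x + g x) - majorant_val \<mu> f \<le> majorant_val \<mu> g"
    by (intro majorant_val_greatest[OF g]) (simp add: algebra_simps)
  then show "majorant_val \<mu> (\<lambda>x. f x + g x) \<le> majorant_val \<mu> f + majorant_val \<mu> g" by simp
next
  fix f :: "real^'n \<Rightarrow> real" and c :: real assume f: "f \<in> poly_growth" and c: "c > 0"
  have "majorant_val \<mu> (\<lambda>x. c * f x) / c \<le> majorant_val \<mu> f"
  proof (rule majorant_val_greatest[OF f])
    fix q assume q: "q \<in> poly_funs" "\<And>x. f x \<le> q x"
    have "majorant_val \<mu> (\<lambda>x. c * f x) \<le> integral\<^sup>L \<mu> (\<lambda>x. c * q x)"
      using c by (intro majorant_val_le[OF \<mu>] fun_subspace_cmult[OF fun_subspace_poly_growth] f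
          poly_funs_cmult q mult_left_mono) auto
    then show "majorant_val \<mu> (\<lambda>x. c * f x) / c \<le> integral\<^sup>L \<mu> q"
      using c by (simp add: field_simps)
  qed
  then show "majorant_val \<mu> (\<lambda>x. c * f x) \<le> c * majorant_val \<mu> f"
    using c by (simp add: field_simps)
qed

text \<open>Take \<Lambda> from Hahn--Banach with equality at g. It is positive because 0 majorises
  - f when f \<ge> 0, and it is the integral on polynomials because p and - p majorise themselves.
  Its representing measure does the rest.\<close>

theorem majorant_val_attained:
  fixes \<mu> :: "(real^'n::finite) measure"
  assumes \<mu>: "admissible \<mu>" and g: "g \<in> poly_growth" "continuous_on UNIV g"
  obtains \<nu> where "admissible \<nu>" "moment_equivalent \<nu> \<mu>" "integral\<^sup>L \<nu> g = majorant_val \<mu> g"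
proof -
  obtain \<Lambda> where \<Lambda>: "linear_on_funs poly_growth \<Lambda>" "\<And>f. f \<in> poly_growth \<Longrightarrow> \<Lambda> f \<le> majorant_val \<mu> f"
    "\<Lambda> g = majorant_val \<mu> g"
    using Hahn_Banach_sublinear[OF fun_subspace_poly_growth majorant_val_sublinear[OF \<mu>] g(1)] by blast
  have uminus: "\<Lambda> (\<lambda>x. - f x) = - \<Lambda> f" if "f \<in> poly_growth" for f
    using linear_on_funs_cmult[OF \<Lambda>(1) that, of "-1"] by simp
  interpret positive_functional \<Lambda>
  proof
    fix f :: "real^'n \<Rightarrow> real" assume f: "f \<in> poly_growth" "\<And>x. 0 \<le> f x"
    have mf: "(\<lambda>x. - f x) \<in> poly_growth" by (rule fun_subspace_uminus[OF fun_subspace_poly_growth f(1)])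
    have "majorant_val \<mu> (\<lambda>x. - f x) \<le> 0"
      using majorant_val_le[OF \<mu> mf poly_funs_const[of 0]] f(2) by simp
    then show "0 \<le> \<Lambda> f" using \<Lambda>(2)[OF mf] uminus[OF f(1)] by simp
  qed (fact \<Lambda>(1))
  have eqL: "\<Lambda> p = integral\<^sup>L \<mu> p" if p: "p \<in> poly_funs" for p
  proof -
    have le: "\<Lambda> p \<le> integral\<^sup>L \<mu> p" if "p \<in> poly_funs" for p
      using \<Lambda>(2)[OF poly_funs_subset_growth[OF that]]
        majorant_val_le[OF \<mu> poly_funs_subset_growth[OF that] that] by simp
    show ?thesis
      using le[OF p] le[OF poly_funs_uminus[OF p]] uminus[OF poly_funs_subset_growth[OF p]] by simp
  qed
  obtain \<nu> where \<nu>: "sets \<nu> = sets borel"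
    "\<And>f. f \<in> poly_growth \<Longrightarrow> continuous_on UNIV f \<Longrightarrow> integrable \<nu> f \<and> integral\<^sup>L \<nu> f = \<Lambda> f"
    using measure_representation by blast
  have poly: "integrable \<nu> p \<and> integral\<^sup>L \<nu> p = integral\<^sup>L \<mu> p" if "p \<in> poly_funs" for p
    using \<nu>(2)[OF poly_funs_subset_growth[OF that] poly_funs_continuous[OF that]] eqL[OF that] by simp
  have "emeasure \<nu> K < \<infinity>" for K
  proof -
    have "integrable \<nu> (\<lambda>x. 1 :: real)" using poly[OF poly_funs_const] by simp
    then have "emeasure \<nu> (space \<nu>) < \<infinity>" by (simp add: integrable_iff_bounded)
    then show ?thesis using emeasure_space[of \<nu> K] by (rule le_less_trans[rotated])
  qed
  then have "admissible \<nu>" using \<nu>(1) poly by (simp add: admissible_def)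
  moreover have "moment_equivalent \<nu> \<mu>" using poly by (simp add: moment_equivalent_def)
  moreover have "integral\<^sup>L \<nu> g = majorant_val \<mu> g" using \<nu>(2)[OF g] \<Lambda>(3) by simp
  ultimately show ?thesis using that by blast
qed

section \<open>Cosines and the gap between the two bounds\<close>

lemma cos_inner_growth: "(\<lambda>x. cos (x \<bullet> \<xi> + \<epsilon>)) \<in> poly_growth"
  by (rule bounded_poly_growth[of _ 1]) (rule abs_cos_le_one)

lemma cos_inner_integrable:
  assumes "admissible \<mu>"
  shows "integrable \<mu> (\<lambda>x. cos (x \<bullet> \<xi> + \<epsilon>))"
proof -
  interpret finite_measure \<mu> using admissible_finite_measure[OF assms] .
  have [measurable_cong]: "sets \<mu> = sets borel" using admissible_sets[OF assms] .
  show ?thesis by (intro integrable_const_bound[of _ 1]) auto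
qed

lemma lower_val_le:
  assumes \<nu>: "admissible \<nu>" "moment_equivalent \<nu> \<mu>"
  shows "lower_val \<mu> \<xi> \<epsilon> \<le> (LINT x|\<nu>. cos (x \<bullet> \<xi> + \<epsilon>))"
  unfolding lower_val_def
proof (rule cSup_least)
  have "(\<lambda>x. -1) \<in> poly_funs \<and> (\<forall>x. -1 \<le> cos (x \<bullet> \<xi> + \<epsilon>))"
    using poly_funs_const by simp
  then show "{integral\<^sup>L \<mu> p |p. p \<in> poly_funs \<and> (\<forall>x. p x \<le> cos (x \<bullet> \<xi> + \<epsilon>))} \<noteq> {}" by blast
next
  fix r assume "r \<in> {integral\<^sup>L \<mu> p |p. p \<in> poly_funs \<and> (\<forall>x. p x \<le> cos (x \<bullet> \<xi> + \<epsilon>))}"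
  then obtain p where p: "p \<in> poly_funs" "\<And>x. p x \<le> cos (x \<bullet> \<xi> + \<epsilon>)" "r = integral\<^sup>L \<nu> p"
    using \<nu>(2) by (auto simp: moment_equivalent_def)
  then show "r \<le> (LINT x|\<nu>. cos (x \<bullet> \<xi> + \<epsilon>))"
    using \<nu>(1) by (auto intro!: integral_mono admissible_integrable cos_inner_integrable)
qed

lemma upper_val_ge:
  assumes \<nu>: "admissible \<nu>" "moment_equivalent \<nu> \<mu>"
  shows "(LINT x|\<nu>. cos (x \<bullet> \<xi> + \<epsilon>)) \<le> upper_val \<mu> \<xi> \<epsilon>"
  unfolding upper_val_def
proof (rule cInf_greatest)
  have "(\<lambda>x. 1) \<in> poly_funs \<and> (\<forall>x. cos (x \<bullet> \<xi> + \<epsilon>) \<le> 1)"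
    using poly_funs_const by simp
  then show "{integral\<^sup>L \<mu> p |p. p \<in> poly_funs \<and> (\<forall>x. cos (x \<bullet> \<xi> + \<epsilon>) \<le> p x)} \<noteq> {}" by blast
next
  fix r assume "r \<in> {integral\<^sup>L \<mu> p |p. p \<in> poly_funs \<and> (\<forall>x. cos (x \<bullet> \<xi> + \<epsilon>) \<le> p x)}"
  then obtain p where p: "p \<in> poly_funs" "\<And>x. cos (x \<bullet> \<xi> + \<epsilon>) \<le> p x" "r = integral\<^sup>L \<nu> p"
    using \<nu>(2) by (auto simp: moment_equivalent_def)
  then show "(LINT x|\<nu>. cos (x \<bullet> \<xi> + \<epsilon>)) \<le> r"
    using \<nu>(1) by (auto intro!: integral_mono admissible_integrable cos_inner_integrable)
qed

text \<open>Negation exchanges majorants of - cos and minorants of cos. Hence a measure attaining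
  the majorant value of - cos integrates the cosine to at most \<open>lower_val\<close>.\<close>

lemma majorant_val_uminus_ge:
  assumes \<mu>: "admissible \<mu>"
  shows "- lower_val \<mu> \<xi> \<epsilon> \<le> majorant_val \<mu> (\<lambda>x. - cos (x \<bullet> \<xi> + \<epsilon>))"
proof (rule majorant_val_greatest[OF fun_subspace_uminus[OF fun_subspace_poly_growth cos_inner_growth]])
  fix q assume q: "q \<in> poly_funs" "\<And>x. - cos (x \<bullet> \<xi> + \<epsilon>) \<le> q x"
  have "integral\<^sup>L \<mu> (\<lambda>x. - q x) \<le> lower_val \<mu> \<xi> \<epsilon>"
    unfolding lower_val_def
  proof (rule cSup_upper)
    show "integral\<^sup>L \<mu> (\<lambda>x. - q x) \<in> {integral\<^sup>L \<mu> p |p. p \<in> poly_funs \<and> (\<forall>x. p x \<le> cos (x \<bullet> \<xi> + \<epsilon>))}"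
      using poly_funs_uminus[OF q(1)] q(2) by (force simp: minus_le_iff)
    show "bdd_above {integral\<^sup>L \<mu> p |p. p \<in> poly_funs \<and> (\<forall>x. p x \<le> cos (x \<bullet> \<xi> + \<epsilon>))}"
      by (rule bdd_aboveI[of _ "LINT x|\<mu>. cos (x \<bullet> \<xi> + \<epsilon>)"])
        (auto intro!: integral_mono admissible_integrable cos_inner_integrable \<mu>)
  qed
  then show "- lower_val \<mu> \<xi> \<epsilon> \<le> integral\<^sup>L \<mu> q" by simp
qed

text \<open>If there is a gap, the value for \<mu> differs from one of its ends, and a moment
  equivalent measure reaches that end or beyond. Conversely, two distinct values both lie between
  the bounds.\<close>

lemma lower_val_less_upper_val_iff:
  fixes \<mu> :: "(real^'n::finite) measure"
  assumes \<mu>: "admissible \<mu>"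
  shows "lower_val \<mu> \<xi> \<epsilon> < upper_val \<mu> \<xi> \<epsilon> \<longleftrightarrow>
    (\<exists>\<nu>. admissible \<nu> \<and> moment_equivalent \<nu> \<mu> \<and>
      (LINT x|\<nu>. cos (x \<bullet> \<xi> + \<epsilon>)) \<noteq> (LINT x|\<mu>. cos (x \<bullet> \<xi> + \<epsilon>)))"
    (is "?L \<longleftrightarrow> ?R")
proof
  let ?f = "\<lambda>x. cos (x \<bullet> \<xi> + \<epsilon>)"
  have cont: "continuous_on UNIV ?f" "continuous_on UNIV (\<lambda>x. - ?f x)" by (intro continuous_intros)+
  assume ?L
  then consider "integral\<^sup>L \<mu> ?f < upper_val \<mu> \<xi> \<epsilon>" | "lower_val \<mu> \<xi> \<epsilon> < integral\<^sup>L \<mu> ?f" by linarith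
  then show ?R
  proof cases
    case 1
    obtain \<nu> where \<nu>: "admissible \<nu>" "moment_equivalent \<nu> \<mu>" "integral\<^sup>L \<nu> ?f = majorant_val \<mu> ?f"
      using majorant_val_attained[OF \<mu> cos_inner_growth cont(1)] by blast
    have "majorant_val \<mu> ?f = upper_val \<mu> \<xi> \<epsilon>"
      by (simp add: majorant_val_def upper_val_def)
    with 1 \<nu> show ?thesis by (intro exI[of _ \<nu>]) simp
  next
    case 2
    obtain \<nu> where \<nu>: "admissible \<nu>" "moment_equivalent \<nu> \<mu>"
      "integral\<^sup>L \<nu> (\<lambda>x. - ?f x) = majorant_val \<mu> (\<lambda>x. - ?f x)"
      using majorant_val_attained[OF \<mu> fun_subspace_uminus[OF fun_subspace_poly_growth cos_inner_growth] cont(2)]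
      by blast
    have "integral\<^sup>L \<nu> ?f \<le> lower_val \<mu> \<xi> \<epsilon>"
      using \<nu>(3) majorant_val_uminus_ge[OF \<mu>, of \<xi> \<epsilon>] by simp
    with 2 \<nu>(1,2) show ?thesis by (intro exI[of _ \<nu>]) simp
  qed
next
  assume ?R
  then obtain \<nu> where \<nu>: "admissible \<nu>" "moment_equivalent \<nu> \<mu>"
    "(LINT x|\<nu>. cos (x \<bullet> \<xi> + \<epsilon>)) \<noteq> (LINT x|\<mu>. cos (x \<bullet> \<xi> + \<epsilon>))" by blast
  have "moment_equivalent \<mu> \<mu>" by (simp add: moment_equivalent_def)
  from lower_val_le[OF \<mu> this, of \<xi> \<epsilon>] upper_val_ge[OF \<mu> this, of \<xi> \<epsilon>]
    lower_val_le[OF \<nu>(1,2), of \<xi> \<epsilon>] upper_val_ge[OF \<nu>(1,2), of \<xi> \<epsilon>] \<nu>(3)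
  show ?L by linarith
qed

text \<open>The phase - pi/2 turns the cosine into the sine, so the two phases give the real and
  imaginary parts of the Fourier transform. At \<xi> = 0 the integrands are constants, hence
  polynomials.\<close>

lemma moment_equivalent_eqI:
  fixes \<mu> \<nu> :: "(real^'n::finite) measure"
  assumes \<mu>: "admissible \<mu>" and \<nu>: "admissible \<nu>" "moment_equivalent \<nu> \<mu>"
    and eq: "\<And>\<xi> \<epsilon>. \<xi> \<noteq> 0 \<Longrightarrow> \<epsilon> \<in> {0, - pi / 2} \<Longrightarrow>
      (LINT x|\<nu>. cos (x \<bullet> \<xi> + \<epsilon>)) = (LINT x|\<mu>. cos (x \<bullet> \<xi> + \<epsilon>))"
  shows "\<nu> = \<mu>"
proof (rule finite_measure_eqI_Fourier)
  have eq': "(LINT x|\<nu>. cos (x \<bullet> \<xi> + \<epsilon>)) = (LINT x|\<mu>. cos (x \<bullet> \<xi> + \<epsilon>))"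
    if "\<epsilon> \<in> {0, - pi / 2}" for \<xi> \<epsilon>
  proof (cases "\<xi> = 0")
    case True
    have "(LINT x|\<nu>. cos \<epsilon>) = (LINT x|\<mu>. cos \<epsilon>)"
      using \<nu>(2) poly_funs_const[of "cos \<epsilon>"] unfolding moment_equivalent_def by blast
    with True show ?thesis by simp
  qed (use eq that in blast)
  have cis: "(CLINT x|M. cis (x \<bullet> \<xi>)) =
      complex_of_real (LINT x|M. cos (x \<bullet> \<xi> + 0)) + \<i> * complex_of_real (LINT x|M. cos (x \<bullet> \<xi> + - pi / 2))"
    if "admissible M" for M :: "(real^'n) measure" and \<xi>
  proof -
    have "cis (x \<bullet> \<xi>) = complex_of_real (cos (x \<bullet> \<xi> + 0)) + \<i> * complex_of_real (cos (x \<bullet> \<xi> + - pi / 2))" for x :: "real^'n"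
      by (simp add: complex_eq_iff cos_diff cos_add)
    then show ?thesis
      using cos_inner_integrable[OF that, of \<xi> 0] cos_inner_integrable[OF that, of \<xi> "- pi / 2"]
      by (simp del: add_0_right)
  qed
  show "(CLINT x|\<nu>. cis (x \<bullet> \<xi>)) = (CLINT x|\<mu>. cis (x \<bullet> \<xi>))" for \<xi>
    unfolding cis[OF \<mu>] cis[OF \<nu>(1)] using eq'[of 0 \<xi>] eq'[of "- pi / 2" \<xi>] by simp
qed (intro admissible_finite_measure admissible_sets \<mu> \<nu>(1))+

lemma cos_inner_integral_continuous:
  fixes \<mu> :: "(real^'n::finite) measure"
  assumes \<mu>: "admissible \<mu>"
  shows "continuous_on UNIV (\<lambda>\<xi>. LINT x|\<mu>. cos (x \<bullet> \<xi> + \<epsilon>))"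
proof -
  interpret finite_measure \<mu> using admissible_finite_measure[OF \<mu>] .
  have [measurable_cong]: "sets \<mu> = sets borel" using admissible_sets[OF \<mu>] .
  show ?thesis
    unfolding continuous_on_sequentially comp_def
  proof (intro allI impI ballI)
    fix \<xi>s :: "nat \<Rightarrow> real^'n" and \<xi> assume "(\<forall>n. \<xi>s n \<in> UNIV) \<and> \<xi>s \<longlonglongrightarrow> \<xi>"
    then have lim: "\<xi>s \<longlonglongrightarrow> \<xi>" by simp
    show "(\<lambda>n. LINT x|\<mu>. cos (x \<bullet> \<xi>s n + \<epsilon>)) \<longlonglongrightarrow> (LINT x|\<mu>. cos (x \<bullet> \<xi> + \<epsilon>))"
    proof (rule integral_dominated_convergence[where w="\<lambda>_. 1"])
      show "AE x in \<mu>. (\<lambda>n. cos (x \<bullet> \<xi>s n + \<epsilon>)) \<longlonglongrightarrow> cos (x \<bullet> \<xi> + \<epsilon>)"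
        by (intro AE_I2 tendsto_intros lim)
    qed auto
  qed
qed

theorem theorem2p1:
  fixes \<mu> :: "(real^'n::finite) measure"
  assumes "admissible \<mu>"
  shows "((\<exists>\<nu>. admissible \<nu> \<and> \<nu> \<noteq> \<mu> \<and> moment_equivalent \<nu> \<mu>) \<longleftrightarrow>
           (\<exists>\<xi> \<epsilon>. \<xi> \<noteq> 0 \<and> \<epsilon> \<in> {0, - pi / 2} \<and> lower_val \<mu> \<xi> \<epsilon> < upper_val \<mu> \<xi> \<epsilon>))
         \<and> (\<forall>\<epsilon>\<in>{0, - pi / 2}. open {\<xi>. \<xi> \<noteq> 0 \<and> lower_val \<mu> \<xi> \<epsilon> < upper_val \<mu> \<xi> \<epsilon>})"
proof (intro conjI ballI)
  note iff = lower_val_less_upper_val_iff[OF assms]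
  show "(\<exists>\<nu>. admissible \<nu> \<and> \<nu> \<noteq> \<mu> \<and> moment_equivalent \<nu> \<mu>) \<longleftrightarrow>
      (\<exists>\<xi> \<epsilon>. \<xi> \<noteq> 0 \<and> \<epsilon> \<in> {0, - pi / 2} \<and> lower_val \<mu> \<xi> \<epsilon> < upper_val \<mu> \<xi> \<epsilon>)"
    unfolding iff using moment_equivalent_eqI[OF assms] by blast
  fix \<epsilon> :: real
  let ?I = "\<lambda>\<nu> \<xi>. LINT x|\<nu>. cos (x \<bullet> \<xi> + \<epsilon>)"
  \<comment> \<open>For each fixed \<nu> the condition says that two continuous functions of \<xi>
    differ; the set is a union of such open sets.\<close>
  have eq: "{\<xi>. \<xi> \<noteq> 0 \<and> lower_val \<mu> \<xi> \<epsilon> < upper_val \<mu> \<xi> \<epsilon>} =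
      (\<Union>\<nu>\<in>{\<nu>. admissible \<nu> \<and> moment_equivalent \<nu> \<mu>}. {\<xi>. \<xi> \<noteq> 0} \<inter> {\<xi>. ?I \<nu> \<xi> \<noteq> ?I \<mu> \<xi>})"
    unfolding iff by blast
  have "open ({\<xi>. \<xi> \<noteq> 0} \<inter> {\<xi>. ?I \<nu> \<xi> \<noteq> ?I \<mu> \<xi>})" if "admissible \<nu>" for \<nu>
    by (intro open_Int open_Collect_neq cos_inner_integral_continuous that assms continuous_intros)
  then show "open {\<xi>. \<xi> \<noteq> 0 \<and> lower_val \<mu> \<xi> \<epsilon> < upper_val \<mu> \<xi> \<epsilon>}"
    unfolding eq by (intro open_UN ballI) blast
qed

end
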